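(* Let $\mathcal A$ be a stable dg category and let $\mathcal S$ be the class of all homotopy short exact sequences in $\mathcal A$. Then $(\mathcal A,\mathcal S)$ is an exact dg category.
   Context: Conventions. $k$ is a commutative ring; all categories are small. For a dg $k$-category $\mathcal A$ (cohomological grading), $Z^0(\mathcal A)$ and $H^0(\mathcal A)$ have the same objects as $\mathcal A$ and morphism spaces $Z^0$, resp. $H^0$, of the Hom complexes. $\mathcal A$ is additive if $H^0(\mathcal A)$ is additive. Up to quasi-equivalence (closing under finite direct sums in the pretriangulated hull), one may take $Z^0(\mathcal A)$ additive when direct sums are used. 3-term h-complexes. $\mathcal H_{3t}(\mathcal A)$ is the following category. Objects (3-term h-complexes): $X=(A_0\xrightarrow{f}A_1\xrightarrow{j}A_2,h)$ with $f,j$ closed of degree $0$ and $h:A_0\to A_2$ of degree $-1$ with $d(h)=-jf$. Morphisms $X\to X'$: homotopy classes of 6-tuples $(r_0,r_1,r_2,s_1,s_2,t)$, $r_i:A_i\to A_i'$ closed of degree $0$, $s_j:A_{j-1}\to A_j'$ of degree $-1$, $t:A_0\to A_2'$ of degree $-2$, with $d(s_1)=f'r_0-r_1f$, $d(s_2)=j'r_1-r_2j$, $d(t)=r_2h-h'r_0-s_2f-j's_1$. Tuples $(r_i,s_j,t)$, $(r'_i,s'_j,t')$ are homotopic if there are $r_i''$ (degree $-1$), $s_j''$ (degree $-2$), $t''$ (degree $-3$) with $r_i-r_i'=d(r_i'')$, $s_1-s_1'=d(s_1'')+f'r_0''-r_1''f$, $s_2-s_2'=d(s_2'')+j'r_1''-r_2''j$,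 $t-t'=d(t'')-j's_1''+h'r_0''-s_2''f+r_2''h$. The composite of $(r',s',t')$ followed by $(r'',s'',t'')$ is $(r_i''r_i',\ r_1''s_1'+s_1''r_0',\ r_2''s_2'+s_2''r_1',\ r_2''t'+t''r_0'-s_2''s_1')$. Homotopy exactness. $X$ is homotopy left exact if for every object $A$ the chain map $u\mapsto(fu,hu)$ from $\mathcal A(A,A_0)$ to the complex with degree $n$ part $\mathcal A(A,A_1)^n\oplus\mathcal A(A,A_2)^{n-1}$ and differential $(v,w)\mapsto(dv,-dw-jv)$ induces isomorphisms on $H^n$ for all $n\le 0$; then $X$ is called a homotopy kernel of $j$. It is homotopy right exact (a homotopy cokernel of $f$) if it is homotopy left exact in $\mathcal A^{op}$, i.e. for every $A$ the chain map $u\mapsto(uj,(-1)^{|u|}uh)$ from $\mathcal A(A_2,A)$ to the complex $\mathcal A(A_1,A)^n\oplus\mathcal A(A_0,A)^{n-1}$ with differential $(v,w)\mapsto(dv,-dw-vf)$ induces isomorphisms on $H^n$, $n\le0$. Homotopy short exact means both. Stable dg categories. An additive dg category $\mathcal A$ is stable if (a) every closed degree $0$ morphism of $\mathcal A$ admits a homotopy kernel and a homotopy cokernel; (b) a 3-term h-complex in $\mathcal A$ is homotopy left exact if and only if it is homotopy right exact. Homotopy squares. A homotopy square consists of closed degree $0$ morphisms $p':B'\to C'$, $b:B'\to B$, $c:C'\to C$, $p:B\to C$ and $s:B'\to C$ of degree $-1$ with $d(s)=cp'-pb$. It is homotopy cartesian (a homotopy pullback of the cospan $B\xrightarrow{p}C\xleftarrow{c}C'$)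 if the 3-term h-complex $(B'\xrightarrow{[b,p']^{\intercal}}B\oplus C'\xrightarrow{[p,-c]}C,\ s)$ is homotopy left exact, and homotopy cocartesian (a homotopy pushout of the span $B\xleftarrow{b}B'\xrightarrow{p'}C'$) if this h-complex is homotopy right exact. Exact structure. An exact structure on an additive dg category $\mathcal A$ is a class $\mathcal S$ of homotopy short exact sequences in $\mathcal H_{3t}(\mathcal A)$, closed under isomorphism, called conflations (in a conflation $(A\xrightarrow{i}B\xrightarrow{p}C,h)$, $i$ is called an inflation and $p$ a deflation) such that: (Ex0) $\mathrm{id}_0$ is a deflation; (Ex1) compositions of deflations are deflations; (Ex2) for a deflation $p:B\to C$ and any $c:C'\to C$ in $Z^0(\mathcal A)$ the cospan $B\xrightarrow{p}C\xleftarrow{c}C'$ has a homotopy pullback and the resulting $p':B'\to C'$ is a deflation; (Ex2$^{op}$) for an inflation $i:A\to B$ and any $a:A\to A'$ in $Z^0(\mathcal A)$ the span $A'\xleftarrow{a}A\xrightarrow{i}B$ has a homotopy pushout and the resulting $i':A'\to B'$ is an inflation. $(\mathcal A,\mathcal S)$ is then called an exact dg category. *)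

theory Defs
  imports Complex_Main "HOL-Library.Function_Algebras" "HOL-Library.Product_Plus"
begin

section \<open>Differential graded categories\<close>

text \<open>
  The modules \<open>Hom A X Y n\<close> are submodules of one ambient \<open>k\<close>-module carried by the type \<open>'m\<close>, on
  which the composition and the differential act. This is no restriction: embed all Hom modules of
  a small dg category in their direct sum, i.e. in its category algebra. Hom modules of
  different pairs of objects or degrees need not be disjoint (they share \<open>0\<close>), so
  notions depending on source, target or degree take these as arguments.
\<close>

record ('o, 'm, 'k) dg_cat =
  Obj :: "'o set"
  Hom :: "'o \<Rightarrow> 'o \<Rightarrow> int \<Rightarrow> 'm set"
  smul :: "'k \<Rightarrow> 'm \<Rightarrow> 'm"
  cmp :: "'m \<Rightarrow> 'm \<Rightarrow> 'm" (infixl \<open>\<cdot>\<index>\<close> 70)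
  dif :: "'m \<Rightarrow> 'm" (\<open>\<d>\<index>\<close>)
  idn :: "'o \<Rightarrow> 'm"

definition koszul :: "int \<Rightarrow> 'm \<Rightarrow> 'm::ab_group_add" where
  "koszul n x = (if even n then x else - x)"

locale dg_category =
  fixes A :: "('o, 'm::ab_group_add, 'k::comm_ring_1) dg_cat" (structure)
  assumes smul_module: "module (smul A)"
    and Hom_subspace:
      "\<lbrakk>X \<in> Obj A; Y \<in> Obj A\<rbrakk> \<Longrightarrow> module.subspace (smul A) (Hom A X Y n)"
    and cmp_closed:
      "\<lbrakk>X \<in> Obj A; Y \<in> Obj A; Z \<in> Obj A; f \<in> Hom A X Y m; g \<in> Hom A Y Z n\<rbrakk>
        \<Longrightarrow> g \<cdot> f \<in> Hom A X Z (n + m)"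
    and cmp_add_left:
      "\<lbrakk>X \<in> Obj A; Y \<in> Obj A; Z \<in> Obj A; f \<in> Hom A X Y m; g \<in> Hom A Y Z n; g' \<in> Hom A Y Z n\<rbrakk>
        \<Longrightarrow> (g + g') \<cdot> f = g \<cdot> f + g' \<cdot> f"
    and cmp_add_right:
      "\<lbrakk>X \<in> Obj A; Y \<in> Obj A; Z \<in> Obj A; f \<in> Hom A X Y m; f' \<in> Hom A X Y m; g \<in> Hom A Y Z n\<rbrakk>
        \<Longrightarrow> g \<cdot> (f + f') = g \<cdot> f + g \<cdot> f'"
    and cmp_smul_left:
      "\<lbrakk>X \<in> Obj A; Y \<in> Obj A; Z \<in> Obj A; f \<in> Hom A X Y m; g \<in> Hom A Y Z n\<rbrakk>
        \<Longrightarrow> smul A c g \<cdot> f = smul A c (g \<cdot> f)"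
    and cmp_smul_right:
      "\<lbrakk>X \<in> Obj A; Y \<in> Obj A; Z \<in> Obj A; f \<in> Hom A X Y m; g \<in> Hom A Y Z n\<rbrakk>
        \<Longrightarrow> g \<cdot> smul A c f = smul A c (g \<cdot> f)"
    and cmp_assoc:
      "\<lbrakk>W \<in> Obj A; X \<in> Obj A; Y \<in> Obj A; Z \<in> Obj A;
        f \<in> Hom A W X l; g \<in> Hom A X Y m; h \<in> Hom A Y Z n\<rbrakk>
        \<Longrightarrow> (h \<cdot> g) \<cdot> f = h \<cdot> (g \<cdot> f)"
    and idn_closed: "X \<in> Obj A \<Longrightarrow> idn A X \<in> Hom A X X 0"
    and idn_left: "\<lbrakk>X \<in> Obj A; Y \<in> Obj A; f \<in> Hom A X Y n\<rbrakk> \<Longrightarrow> idn A Y \<cdot> f = f"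
    and idn_right: "\<lbrakk>X \<in> Obj A; Y \<in> Obj A; f \<in> Hom A X Y n\<rbrakk> \<Longrightarrow> f \<cdot> idn A X = f"
    and dif_closed: "\<lbrakk>X \<in> Obj A; Y \<in> Obj A; f \<in> Hom A X Y n\<rbrakk> \<Longrightarrow> \<d> f \<in> Hom A X Y (n + 1)"
    and dif_add:
      "\<lbrakk>X \<in> Obj A; Y \<in> Obj A; f \<in> Hom A X Y n; f' \<in> Hom A X Y n\<rbrakk> \<Longrightarrow> \<d> (f + f') = \<d> f + \<d> f'"
    and dif_smul: "\<lbrakk>X \<in> Obj A; Y \<in> Obj A; f \<in> Hom A X Y n\<rbrakk> \<Longrightarrow> \<d> (smul A c f) = smul A c (\<d> f)"
    and dif_dif: "\<lbrakk>X \<in> Obj A; Y \<in> Obj A; f \<in> Hom A X Y n\<rbrakk> \<Longrightarrow> \<d> (\<d> f) = 0"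
    and leibniz:
      "\<lbrakk>X \<in> Obj A; Y \<in> Obj A; Z \<in> Obj A; f \<in> Hom A X Y m; g \<in> Hom A Y Z n\<rbrakk>
        \<Longrightarrow> \<d> (g \<cdot> f) = \<d> g \<cdot> f + koszul n (g \<cdot> \<d> f)"

definition Z0 :: "('o, 'm::ab_group_add, 'k) dg_cat \<Rightarrow> 'o \<Rightarrow> 'o \<Rightarrow> 'm set" where
  "Z0 A X Y = {f \<in> Hom A X Y 0. dif A f = 0}"

text \<open>Equality in \<open>H\<^sup>0(A)(X, Y)\<close> of the classes of two elements of \<open>Z\<^sup>0(A)(X, Y)\<close>.\<close>

definition eq_H0 :: "('o, 'm::ab_group_add, 'k) dg_cat \<Rightarrow> 'o \<Rightarrow> 'o \<Rightarrow> 'm \<Rightarrow> 'm \<Rightarrow> bool" where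
  "eq_H0 A X Y f g \<longleftrightarrow> f \<in> Z0 A X Y \<and> g \<in> Z0 A X Y \<and> f - g \<in> dif A ` Hom A X Y (-1)"

definition zero_object_H0 :: "('o, 'm::ab_group_add, 'k) dg_cat \<Rightarrow> 'o \<Rightarrow> bool" where
  "zero_object_H0 A N \<longleftrightarrow> N \<in> Obj A \<and>
    (\<forall>X \<in> Obj A. (\<forall>f \<in> Z0 A X N. eq_H0 A X N f 0) \<and> (\<forall>f \<in> Z0 A N X. eq_H0 A N X f 0))"

definition biproduct_H0 ::
  "('o, 'm::ab_group_add, 'k) dg_cat \<Rightarrow> 'o \<Rightarrow> 'o \<Rightarrow> 'o \<Rightarrow> 'm \<Rightarrow> 'm \<Rightarrow> 'm \<Rightarrow> 'm \<Rightarrow> bool" where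
  "biproduct_H0 A X Y D \<iota>\<^sub>1 \<iota>\<^sub>2 \<pi>\<^sub>1 \<pi>\<^sub>2 \<longleftrightarrow> D \<in> Obj A \<and>
    \<iota>\<^sub>1 \<in> Z0 A X D \<and> \<iota>\<^sub>2 \<in> Z0 A Y D \<and> \<pi>\<^sub>1 \<in> Z0 A D X \<and> \<pi>\<^sub>2 \<in> Z0 A D Y \<and>
    eq_H0 A X X (\<pi>\<^sub>1 \<cdot>\<^bsub>A\<^esub> \<iota>\<^sub>1) (idn A X) \<and> eq_H0 A Y Y (\<pi>\<^sub>2 \<cdot>\<^bsub>A\<^esub> \<iota>\<^sub>2) (idn A Y) \<and>
    eq_H0 A Y X (\<pi>\<^sub>1 \<cdot>\<^bsub>A\<^esub> \<iota>\<^sub>2) 0 \<and> eq_H0 A X Y (\<pi>\<^sub>2 \<cdot>\<^bsub>A\<^esub> \<iota>\<^sub>1) 0 \<and>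
    eq_H0 A D D (\<iota>\<^sub>1 \<cdot>\<^bsub>A\<^esub> \<pi>\<^sub>1 + \<iota>\<^sub>2 \<cdot>\<^bsub>A\<^esub> \<pi>\<^sub>2) (idn A D)"

definition additive_dg :: "('o, 'm::ab_group_add, 'k::comm_ring_1) dg_cat \<Rightarrow> bool" where
  "additive_dg A \<longleftrightarrow> dg_category A \<and> (\<exists>N. zero_object_H0 A N) \<and>
    (\<forall>X \<in> Obj A. \<forall>Y \<in> Obj A. \<exists>D \<iota>\<^sub>1 \<iota>\<^sub>2 \<pi>\<^sub>1 \<pi>\<^sub>2. biproduct_H0 A X Y D \<iota>\<^sub>1 \<iota>\<^sub>2 \<pi>\<^sub>1 \<pi>\<^sub>2)"


section \<open>Cohomology of complexes\<close>

text \<open>A complex is a family \<open>C n\<close> of subgroups with a differential \<open>d\<close> mapping \<open>C n\<close> to \<open>C (n + 1)\<close>.\<close>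

definition cocycles :: "(int \<Rightarrow> 'a set) \<Rightarrow> ('a \<Rightarrow> 'a) \<Rightarrow> int \<Rightarrow> 'a::ab_group_add set" where
  "cocycles C d n = {x \<in> C n. d x = 0}"

definition cohomologous :: "(int \<Rightarrow> 'a set) \<Rightarrow> ('a \<Rightarrow> 'a) \<Rightarrow> int \<Rightarrow> ('a::ab_group_add \<times> 'a) set" where
  "cohomologous C d n =
    {(x, y). x \<in> cocycles C d n \<and> y \<in> cocycles C d n \<and> x - y \<in> d ` C (n - 1)}"

definition cohomology :: "(int \<Rightarrow> 'a set) \<Rightarrow> ('a \<Rightarrow> 'a) \<Rightarrow> int \<Rightarrow> 'a::ab_group_add set set" where
  "cohomology C d n = cocycles C d n // cohomologous C d n"

text \<open>
  \<open>\<phi>\<close> is the degree \<open>n\<close> component of a chain map. The cohomology class \<open>c\<close> is a set of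
  cocycles and is sent to the class containing \<open>\<phi> ` c\<close>.
\<close>

definition iso_on_cohomology ::
  "(int \<Rightarrow> 'a::ab_group_add set) \<Rightarrow> ('a \<Rightarrow> 'a) \<Rightarrow> (int \<Rightarrow> 'b::ab_group_add set) \<Rightarrow> ('b \<Rightarrow> 'b) \<Rightarrow>
    int \<Rightarrow> ('a \<Rightarrow> 'b) \<Rightarrow> bool" where
  "iso_on_cohomology C d C' d' n \<phi> \<longleftrightarrow>
    bij_betw (\<lambda>c. cohomologous C' d' n `` (\<phi> ` c)) (cohomology C d n) (cohomology C' d' n)"


section \<open>3-term h-complexes\<close>

record ('o, 'm) three_term =
  ob0 :: 'o
  ob1 :: 'o
  ob2 :: 'o
  map_f :: 'm
  map_j :: 'm
  map_h :: 'm

definition h_complex :: "('o, 'm::ab_group_add, 'k) dg_cat \<Rightarrow> ('o, 'm) three_term \<Rightarrow> bool" where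
  "h_complex A X \<longleftrightarrow>
    ob0 X \<in> Obj A \<and> ob1 X \<in> Obj A \<and> ob2 X \<in> Obj A \<and>
    map_f X \<in> Z0 A (ob0 X) (ob1 X) \<and> map_j X \<in> Z0 A (ob1 X) (ob2 X) \<and>
    map_h X \<in> Hom A (ob0 X) (ob2 X) (-1) \<and>
    dif A (map_h X) = - (map_j X \<cdot>\<^bsub>A\<^esub> map_f X)"

record 'm six_tuple =
  r0 :: 'm
  r1 :: 'm
  r2 :: 'm
  s1 :: 'm
  s2 :: 'm
  tt :: 'm

definition h_morphism ::
  "('o, 'm::ab_group_add, 'k) dg_cat \<Rightarrow> ('o, 'm) three_term \<Rightarrow> ('o, 'm) three_term \<Rightarrow>
    'm six_tuple \<Rightarrow> bool" where
  "h_morphism A X X' m \<longleftrightarrow>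
    r0 m \<in> Z0 A (ob0 X) (ob0 X') \<and> r1 m \<in> Z0 A (ob1 X) (ob1 X') \<and> r2 m \<in> Z0 A (ob2 X) (ob2 X') \<and>
    s1 m \<in> Hom A (ob0 X) (ob1 X') (-1) \<and> s2 m \<in> Hom A (ob1 X) (ob2 X') (-1) \<and>
    tt m \<in> Hom A (ob0 X) (ob2 X') (-2) \<and>
    dif A (s1 m) = map_f X' \<cdot>\<^bsub>A\<^esub> r0 m - r1 m \<cdot>\<^bsub>A\<^esub> map_f X \<and>
    dif A (s2 m) = map_j X' \<cdot>\<^bsub>A\<^esub> r1 m - r2 m \<cdot>\<^bsub>A\<^esub> map_j X \<and>
    dif A (tt m) = r2 m \<cdot>\<^bsub>A\<^esub> map_h X - map_h X' \<cdot>\<^bsub>A\<^esub> r0 m - s2 m \<cdot>\<^bsub>A\<^esub> map_f X - map_j X' \<cdot>\<^bsub>A\<^esub> s1 m"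

definition h_homotopic ::
  "('o, 'm::ab_group_add, 'k) dg_cat \<Rightarrow> ('o, 'm) three_term \<Rightarrow> ('o, 'm) three_term \<Rightarrow>
    'm six_tuple \<Rightarrow> 'm six_tuple \<Rightarrow> bool" where
  "h_homotopic A X X' m m' \<longleftrightarrow>
    (\<exists>\<rho>\<^sub>0 \<in> Hom A (ob0 X) (ob0 X') (-1). \<exists>\<rho>\<^sub>1 \<in> Hom A (ob1 X) (ob1 X') (-1).
     \<exists>\<rho>\<^sub>2 \<in> Hom A (ob2 X) (ob2 X') (-1).
     \<exists>\<sigma>\<^sub>1 \<in> Hom A (ob0 X) (ob1 X') (-2). \<exists>\<sigma>\<^sub>2 \<in> Hom A (ob1 X) (ob2 X') (-2).
     \<exists>\<tau> \<in> Hom A (ob0 X) (ob2 X') (-3).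
      r0 m - r0 m' = dif A \<rho>\<^sub>0 \<and> r1 m - r1 m' = dif A \<rho>\<^sub>1 \<and> r2 m - r2 m' = dif A \<rho>\<^sub>2 \<and>
      s1 m - s1 m' = dif A \<sigma>\<^sub>1 + map_f X' \<cdot>\<^bsub>A\<^esub> \<rho>\<^sub>0 - \<rho>\<^sub>1 \<cdot>\<^bsub>A\<^esub> map_f X \<and>
      s2 m - s2 m' = dif A \<sigma>\<^sub>2 + map_j X' \<cdot>\<^bsub>A\<^esub> \<rho>\<^sub>1 - \<rho>\<^sub>2 \<cdot>\<^bsub>A\<^esub> map_j X \<and>
      tt m - tt m' = dif A \<tau> - map_j X' \<cdot>\<^bsub>A\<^esub> \<sigma>\<^sub>1 + map_h X' \<cdot>\<^bsub>A\<^esub> \<rho>\<^sub>0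
        - \<sigma>\<^sub>2 \<cdot>\<^bsub>A\<^esub> map_f X + \<rho>\<^sub>2 \<cdot>\<^bsub>A\<^esub> map_h X)"

text \<open>\<open>h_comp A m' m\<close> is \<open>m\<close> followed by \<open>m'\<close>.\<close>

definition h_comp ::
  "('o, 'm::ab_group_add, 'k) dg_cat \<Rightarrow> 'm six_tuple \<Rightarrow> 'm six_tuple \<Rightarrow> 'm six_tuple" where
  "h_comp A m' m = \<lparr>
    r0 = r0 m' \<cdot>\<^bsub>A\<^esub> r0 m, r1 = r1 m' \<cdot>\<^bsub>A\<^esub> r1 m, r2 = r2 m' \<cdot>\<^bsub>A\<^esub> r2 m,
    s1 = r1 m' \<cdot>\<^bsub>A\<^esub> s1 m + s1 m' \<cdot>\<^bsub>A\<^esub> r0 m,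
    s2 = r2 m' \<cdot>\<^bsub>A\<^esub> s2 m + s2 m' \<cdot>\<^bsub>A\<^esub> r1 m,
    tt = r2 m' \<cdot>\<^bsub>A\<^esub> tt m + tt m' \<cdot>\<^bsub>A\<^esub> r0 m - s2 m' \<cdot>\<^bsub>A\<^esub> s1 m\<rparr>"

definition h_id ::
  "('o, 'm::ab_group_add, 'k) dg_cat \<Rightarrow> ('o, 'm) three_term \<Rightarrow> 'm six_tuple" where
  "h_id A X = \<lparr>r0 = idn A (ob0 X), r1 = idn A (ob1 X), r2 = idn A (ob2 X), s1 = 0, s2 = 0, tt = 0\<rparr>"

text \<open>Isomorphism in the category of 3-term h-complexes and homotopy classes of 6-tuples.\<close>

definition h_isomorphic ::
  "('o, 'm::ab_group_add, 'k) dg_cat \<Rightarrow> ('o, 'm) three_term \<Rightarrow> ('o, 'm) three_term \<Rightarrow> bool" where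
  "h_isomorphic A X X' \<longleftrightarrow> h_complex A X \<and> h_complex A X' \<and>
    (\<exists>m m'. h_morphism A X X' m \<and> h_morphism A X' X m' \<and>
      h_homotopic A X X (h_comp A m' m) (h_id A X) \<and>
      h_homotopic A X' X' (h_comp A m m') (h_id A X'))"


section \<open>Homotopy exactness and stability\<close>

definition h_left_exact :: "('o, 'm::ab_group_add, 'k) dg_cat \<Rightarrow> ('o, 'm) three_term \<Rightarrow> bool" where
  "h_left_exact A X \<longleftrightarrow> h_complex A X \<and>
    (\<forall>Y \<in> Obj A. \<forall>n \<le> 0. iso_on_cohomology
      (\<lambda>i. Hom A Y (ob0 X) i) (dif A)
      (\<lambda>i. Hom A Y (ob1 X) i \<times> Hom A Y (ob2 X) (i - 1))
      (\<lambda>(v, w). (dif A v, - dif A w - map_j X \<cdot>\<^bsub>A\<^esub> v))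
      n (\<lambda>u. (map_f X \<cdot>\<^bsub>A\<^esub> u, map_h X \<cdot>\<^bsub>A\<^esub> u)))"

definition h_right_exact :: "('o, 'm::ab_group_add, 'k) dg_cat \<Rightarrow> ('o, 'm) three_term \<Rightarrow> bool" where
  "h_right_exact A X \<longleftrightarrow> h_complex A X \<and>
    (\<forall>Y \<in> Obj A. \<forall>n \<le> 0. iso_on_cohomology
      (\<lambda>i. Hom A (ob2 X) Y i) (dif A)
      (\<lambda>i. Hom A (ob1 X) Y i \<times> Hom A (ob0 X) Y (i - 1))
      (\<lambda>(v, w). (dif A v, - dif A w - v \<cdot>\<^bsub>A\<^esub> map_f X))
      n (\<lambda>u. (u \<cdot>\<^bsub>A\<^esub> map_j X, koszul n (u \<cdot>\<^bsub>A\<^esub> map_h X))))"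

definition h_short_exact :: "('o, 'm::ab_group_add, 'k) dg_cat \<Rightarrow> ('o, 'm) three_term \<Rightarrow> bool" where
  "h_short_exact A X \<longleftrightarrow> h_left_exact A X \<and> h_right_exact A X"

definition h_kernel ::
  "('o, 'm::ab_group_add, 'k) dg_cat \<Rightarrow> 'o \<Rightarrow> 'o \<Rightarrow> 'm \<Rightarrow> ('o, 'm) three_term \<Rightarrow> bool" where
  "h_kernel A P Q j X \<longleftrightarrow> h_left_exact A X \<and> ob1 X = P \<and> ob2 X = Q \<and> map_j X = j"

definition h_cokernel ::
  "('o, 'm::ab_group_add, 'k) dg_cat \<Rightarrow> 'o \<Rightarrow> 'o \<Rightarrow> 'm \<Rightarrow> ('o, 'm) three_term \<Rightarrow> bool" where
  "h_cokernel A P Q f X \<longleftrightarrow> h_right_exact A X \<and> ob0 X = P \<and> ob1 X = Q \<and> map_f X = f"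

definition stable_dg :: "('o, 'm::ab_group_add, 'k::comm_ring_1) dg_cat \<Rightarrow> bool" where
  "stable_dg A \<longleftrightarrow> additive_dg A \<and>
    (\<forall>P \<in> Obj A. \<forall>Q \<in> Obj A. \<forall>f \<in> Z0 A P Q. (\<exists>X. h_kernel A P Q f X) \<and> (\<exists>X. h_cokernel A P Q f X)) \<and>
    (\<forall>X. h_complex A X \<longrightarrow> (h_left_exact A X \<longleftrightarrow> h_right_exact A X))"


section \<open>Closure under finite direct sums\<close>

text \<open>
  Formal finite direct sums: objects are lists of objects, morphisms \<open>xs \<rightarrow> ys\<close> are matrices,
  with entry \<open>(i, j)\<close> in \<open>Hom (xs ! j) (ys ! i)\<close> and zero outside the
  index range. When \<open>A\<close> is additive, the full embedding \<open>X \<mapsto> [X]\<close> is a quasi-equivalence. In the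
  product of \<open>M\<close> and \<open>N\<close> the condition \<open>N k j \<noteq> 0\<close> makes the sum range over finitely many indices
  \<open>k\<close>, all of them valid; the omitted terms vanish.
\<close>

definition sum_closure ::
  "('o, 'm::ab_group_add, 'k) dg_cat \<Rightarrow> ('o list, nat \<Rightarrow> nat \<Rightarrow> 'm, 'k) dg_cat" where
  "sum_closure A = \<lparr>
    Obj = lists (Obj A),
    Hom = (\<lambda>xs ys n. {M. \<forall>i j.
      if i < length ys \<and> j < length xs then M i j \<in> Hom A (xs ! j) (ys ! i) n else M i j = 0}),
    smul = (\<lambda>c M i j. smul A c (M i j)),
    cmp = (\<lambda>M N i j. \<Sum>k | N k j \<noteq> 0. M i k \<cdot>\<^bsub>A\<^esub> N k j),
    dif = (\<lambda>M i j. dif A (M i j)),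
    idn = (\<lambda>xs i j. if i = j \<and> i < length xs then idn A (xs ! i) else 0)\<rparr>"

definition matrix_of :: "'m::zero list list \<Rightarrow> nat \<Rightarrow> nat \<Rightarrow> 'm" where
  "matrix_of rows i j = (if i < length rows \<and> j < length (rows ! i) then rows ! i ! j else 0)"


section \<open>Homotopy squares\<close>

record ('o, 'm) square =
  sq_B' :: 'o
  sq_C' :: 'o
  sq_B :: 'o
  sq_C :: 'o
  sq_p' :: 'm
  sq_b :: 'm
  sq_c :: 'm
  sq_p :: 'm
  sq_s :: 'm

definition h_square :: "('o, 'm::ab_group_add, 'k) dg_cat \<Rightarrow> ('o, 'm) square \<Rightarrow> bool" where
  "h_square A Q \<longleftrightarrow>
    sq_B' Q \<in> Obj A \<and> sq_C' Q \<in> Obj A \<and> sq_B Q \<in> Obj A \<and> sq_C Q \<in> Obj A \<and>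
    sq_p' Q \<in> Z0 A (sq_B' Q) (sq_C' Q) \<and> sq_b Q \<in> Z0 A (sq_B' Q) (sq_B Q) \<and>
    sq_c Q \<in> Z0 A (sq_C' Q) (sq_C Q) \<and> sq_p Q \<in> Z0 A (sq_B Q) (sq_C Q) \<and>
    sq_s Q \<in> Hom A (sq_B' Q) (sq_C Q) (-1) \<and>
    dif A (sq_s Q) = sq_c Q \<cdot>\<^bsub>A\<^esub> sq_p' Q - sq_p Q \<cdot>\<^bsub>A\<^esub> sq_b Q"

text \<open>
  The direct sum \<open>B \<oplus> C'\<close> exists in \<open>A\<close> only up to homotopy, hence \<open>B' \<rightarrow> B \<oplus> C' \<rightarrow> C\<close> is a 3-term
  h-complex in the closure of \<open>A\<close> under finite direct sums.
\<close>

definition square_complex ::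
  "('o, 'm::ab_group_add) square \<Rightarrow> ('o list, nat \<Rightarrow> nat \<Rightarrow> 'm) three_term" where
  "square_complex Q = \<lparr>
    ob0 = [sq_B' Q], ob1 = [sq_B Q, sq_C' Q], ob2 = [sq_C Q],
    map_f = matrix_of [[sq_b Q], [sq_p' Q]],
    map_j = matrix_of [[sq_p Q, - sq_c Q]],
    map_h = matrix_of [[sq_s Q]]\<rparr>"

definition h_cartesian :: "('o, 'm::ab_group_add, 'k) dg_cat \<Rightarrow> ('o, 'm) square \<Rightarrow> bool" where
  "h_cartesian A Q \<longleftrightarrow> h_square A Q \<and> h_left_exact (sum_closure A) (square_complex Q)"

definition h_cocartesian :: "('o, 'm::ab_group_add, 'k) dg_cat \<Rightarrow> ('o, 'm) square \<Rightarrow> bool" where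
  "h_cocartesian A Q \<longleftrightarrow> h_square A Q \<and> h_right_exact (sum_closure A) (square_complex Q)"

text \<open>\<open>Q\<close> is a homotopy pullback of the cospan \<open>B \<rightarrow> C \<leftarrow> C'\<close> given by \<open>p\<close> and \<open>c\<close>.\<close>

definition h_pullback ::
  "('o, 'm::ab_group_add, 'k) dg_cat \<Rightarrow> 'o \<Rightarrow> 'o \<Rightarrow> 'o \<Rightarrow> 'm \<Rightarrow> 'm \<Rightarrow> ('o, 'm) square \<Rightarrow> bool" where
  "h_pullback A B C C' p c Q \<longleftrightarrow> h_cartesian A Q \<and>
    sq_B Q = B \<and> sq_C Q = C \<and> sq_C' Q = C' \<and> sq_p Q = p \<and> sq_c Q = c"

text \<open>\<open>Q\<close> is a homotopy pushout of the span \<open>B \<leftarrow> B' \<rightarrow> C'\<close> given by \<open>b\<close> and \<open>p'\<close>.\<close>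

definition h_pushout ::
  "('o, 'm::ab_group_add, 'k) dg_cat \<Rightarrow> 'o \<Rightarrow> 'o \<Rightarrow> 'o \<Rightarrow> 'm \<Rightarrow> 'm \<Rightarrow> ('o, 'm) square \<Rightarrow> bool" where
  "h_pushout A B B' C' b p' Q \<longleftrightarrow> h_cocartesian A Q \<and>
    sq_B Q = B \<and> sq_B' Q = B' \<and> sq_C' Q = C' \<and> sq_b Q = b \<and> sq_p' Q = p'"


section \<open>Exact structures\<close>

text \<open>
  In (Ex2) and its dual, homotopy pullbacks and pushouts exist and the condition on the resulting
  morphism is imposed on each of them.
\<close>

definition inflation :: "('o, 'm) three_term set \<Rightarrow> 'o \<Rightarrow> 'o \<Rightarrow> 'm \<Rightarrow> bool" where
  "inflation S P Q i \<longleftrightarrow> (\<exists>X \<in> S. ob0 X = P \<and> ob1 X = Q \<and> map_f X = i)"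

definition deflation :: "('o, 'm) three_term set \<Rightarrow> 'o \<Rightarrow> 'o \<Rightarrow> 'm \<Rightarrow> bool" where
  "deflation S P Q p \<longleftrightarrow> (\<exists>X \<in> S. ob1 X = P \<and> ob2 X = Q \<and> map_j X = p)"

locale exact_structure =
  fixes A :: "('o, 'm::ab_group_add, 'k::comm_ring_1) dg_cat" (structure)
    and S :: "('o, 'm) three_term set"
  assumes conflation_exact: "X \<in> S \<Longrightarrow> h_short_exact A X"
    and iso_closed: "\<lbrakk>X \<in> S; h_isomorphic A X X'\<rbrakk> \<Longrightarrow> X' \<in> S"
    and Ex0: "zero_object_H0 A N \<Longrightarrow> deflation S N N (idn A N)"
    and Ex1: "\<lbrakk>deflation S B C p; deflation S C D q\<rbrakk> \<Longrightarrow> deflation S B D (q \<cdot> p)"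
    and Ex2_exists: "\<lbrakk>deflation S B C p; C' \<in> Obj A; c \<in> Z0 A C' C\<rbrakk>
      \<Longrightarrow> \<exists>Q. h_pullback A B C C' p c Q"
    and Ex2_deflation: "\<lbrakk>deflation S B C p; C' \<in> Obj A; c \<in> Z0 A C' C; h_pullback A B C C' p c Q\<rbrakk>
      \<Longrightarrow> deflation S (sq_B' Q) C' (sq_p' Q)"
    and Ex2op_exists: "\<lbrakk>inflation S P B i; P' \<in> Obj A; a \<in> Z0 A P P'\<rbrakk>
      \<Longrightarrow> \<exists>Q. h_pushout A P' P B a i Q"
    and Ex2op_inflation: "\<lbrakk>inflation S P B i; P' \<in> Obj A; a \<in> Z0 A P P'; h_pushout A P' P B a i Q\<rbrakk>
      \<Longrightarrow> inflation S P' (sq_C Q) (sq_p Q)"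

definition exact_dg_category ::
  "('o, 'm::ab_group_add, 'k::comm_ring_1) dg_cat \<Rightarrow> ('o, 'm) three_term set \<Rightarrow> bool" where
  "exact_dg_category A S \<longleftrightarrow> additive_dg A \<and> exact_structure A S"

end

theory Submission
  imports Defs
begin

text \<open>
  In a stable dg category a homotopy kernel of a closed morphism of degree \<open>0\<close> is also homotopy
  right exact, so every such morphism is a deflation and, dually, an inflation. What remains of
  the axioms is the existence of homotopy pullbacks and pushouts and the closure under isomorphism.
  The pullback of \<open>p\<close> and \<open>c\<close> is the homotopy kernel of \<open>p \<cdot> \<pi>\<^sub>1 - c \<cdot> \<pi>\<^sub>2\<close> on a biproduct \<open>D\<close> of
  \<open>B\<close> and \<open>C'\<close> in \<open>H\<^sup>0\<close>. It is carried over to the formal direct sum \<open>[B, C']\<close> along the homotopy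
  equivalence \<open>D \<rightarrow> [B, C']\<close>; no coherence problem arises since the map to \<open>C\<close> factors strictly
  through it. Exactness is invariant under isomorphism because it says that certain maps on
  cohomology are bijective, a property that passes to retracts.
\<close>

section \<open>Cohomology\<close>

text \<open>Stability is an assumption on \<open>A\<close> alone, whereas homotopy squares are
  tested in \<open>sum_closure A\<close>, where neither kernels nor the equivalence of left and
  right exactness are available. Both are therefore used only inside \<open>A\<close>, and the
  exactness obtained there is transported to the closure.

  Bijectivity on cohomology is first rewritten as a statement about elements, for one test object
  and one degree \<open>n\<close> at a time. Passing to a retract and replacing the middle object
  preserve it for a fixed test object and degree; passing to the closure treats the entries of a
  list separately, in the same degree. Hence the bound \<open>n \<le> 0\<close> never interferes
  with a transfer, although the auxiliary cochains have degrees \<open>n - 1\<close> and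
  \<open>n - 2\<close>.

  Instead of forming an opposite category, the dual computations are carried out directly, with the
  Koszul signs of precomposition. The exception is closure under isomorphism: there only left
  exactness is transported, and stability returns right exactness.\<close>

lemma equiv_cohomologous:
  assumes zero: "0 \<in> C n" "0 \<in> C (n - 1)"
    and diff: "\<And>x y. x \<in> C n \<Longrightarrow> y \<in> C n \<Longrightarrow> x - y \<in> C n"
      "\<And>x y. x \<in> C (n - 1) \<Longrightarrow> y \<in> C (n - 1) \<Longrightarrow> x - y \<in> C (n - 1)"
    and d_diff: "\<And>x y. x \<in> C (n - 1) \<Longrightarrow> y \<in> C (n - 1) \<Longrightarrow> d (x - y) = d x - d y"
  shows "equiv (cocycles C d n) (cohomologous C d n)"
proof (rule equivI)
  have d0: "d 0 = 0"
    using d_diff[OF zero(2) zero(2)] by simp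
  show "cohomologous C d n \<subseteq> cocycles C d n \<times> cocycles C d n"
    by (auto simp: cohomologous_def)
  show "refl_on (cocycles C d n) (cohomologous C d n)"
    using imageI[OF zero(2), of d] d0 by (simp add: refl_on_def cohomologous_def)
  have neg: "- x \<in> d ` C (n - 1)" if "x \<in> d ` C (n - 1)" for x
  proof -
    from that obtain y where "y \<in> C (n - 1)" "x = d y" by blast
    then have "- x = d (0 - y)" "0 - y \<in> C (n - 1)"
      using d_diff[OF zero(2)] diff(2)[OF zero(2)] d0 by simp_all
    then show ?thesis by blast
  qed
  show "sym (cohomologous C d n)"
    unfolding sym_def cohomologous_def using neg by (metis (mono_tags, lifting) case_prodD case_prodI mem_Collect_eq minus_diff_eq)
  have add: "x + y \<in> d ` C (n - 1)" if "x \<in> d ` C (n - 1)" "y \<in> d ` C (n - 1)" for x y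
  proof -
    from that(1) neg[OF that(2)] obtain u v where "u \<in> C (n - 1)" "v \<in> C (n - 1)" "x = d u" "- y = d v"
      by blast
    then have "x + y = d (u - v)" "u - v \<in> C (n - 1)"
      by (simp_all add: d_diff diff flip: diff_minus_eq_add)
    then show ?thesis by blast
  qed
  show "trans (cohomologous C d n)"
  proof (rule transI)
    fix x y z assume "(x, y) \<in> cohomologous C d n" "(y, z) \<in> cohomologous C d n"
    then show "(x, z) \<in> cohomologous C d n"
      using add[of "x - y" "y - z"] by (simp add: cohomologous_def)
  qed
qed

text \<open>A homomorphism of quotient groups is injective iff its kernel is trivial; the hypotheses
  are relative to \<open>C n\<close> and \<open>C (n - 1)\<close> because additivity holds only on
  these subsets. Only the component \<open>\<phi>\<close> of degree \<open>n\<close> is given, so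
  the chain map property enters as preservation of cocycles and of boundaries. This accommodates the
  comparison map of right exactness, whose sign changes with the degree.\<close>

lemma iso_on_cohomology_iff:
  assumes zero: "0 \<in> C n" "0 \<in> C (n - 1)"
    and diff: "\<And>x y. x \<in> C n \<Longrightarrow> y \<in> C n \<Longrightarrow> x - y \<in> C n"
      "\<And>x y. x \<in> C (n - 1) \<Longrightarrow> y \<in> C (n - 1) \<Longrightarrow> x - y \<in> C (n - 1)"
    and d_diff: "\<And>x y. x \<in> C n \<Longrightarrow> y \<in> C n \<Longrightarrow> d (x - y) = d x - d y"
      "\<And>x y. x \<in> C (n - 1) \<Longrightarrow> y \<in> C (n - 1) \<Longrightarrow> d (x - y) = d x - d y"
    and zero': "0 \<in> C' n" "0 \<in> C' (n - 1)"
    and diff': "\<And>x y. x \<in> C' n \<Longrightarrow> y \<in> C' n \<Longrightarrow> x - y \<in> C' n"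
      "\<And>x y. x \<in> C' (n - 1) \<Longrightarrow> y \<in> C' (n - 1) \<Longrightarrow> x - y \<in> C' (n - 1)"
    and d'_diff: "\<And>x y. x \<in> C' (n - 1) \<Longrightarrow> y \<in> C' (n - 1) \<Longrightarrow> d' (x - y) = d' x - d' y"
    and \<phi>_diff: "\<And>x y. x \<in> C n \<Longrightarrow> y \<in> C n \<Longrightarrow> \<phi> (x - y) = \<phi> x - \<phi> y"
    and \<phi>_cocycle: "\<And>x. x \<in> cocycles C d n \<Longrightarrow> \<phi> x \<in> cocycles C' d' n"
    and \<phi>_boundary: "\<And>x. x \<in> C (n - 1) \<Longrightarrow> \<phi> (d x) \<in> d' ` C' (n - 1)"
  shows "iso_on_cohomology C d C' d' n \<phi> \<longleftrightarrow>
    (\<forall>x \<in> cocycles C d n. \<phi> x \<in> d' ` C' (n - 1) \<longrightarrow> x \<in> d ` C (n - 1)) \<and>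
    (\<forall>y \<in> cocycles C' d' n. \<exists>x \<in> cocycles C d n. y - \<phi> x \<in> d' ` C' (n - 1))"
    (is "_ \<longleftrightarrow> ?inj \<and> ?surj")
proof -
  let ?Z = "cocycles C d n" and ?Z' = "cocycles C' d' n"
  let ?E = "cohomologous C d n" and ?E' = "cohomologous C' d' n"
  have E: "equiv ?Z ?E" by (rule equiv_cohomologous) (fact zero diff d_diff)+
  have E': "equiv ?Z' ?E'" by (rule equiv_cohomologous) (fact zero' diff' d'_diff)+
  have resp: "(\<phi> x, \<phi> y) \<in> ?E'" if xy: "(x, y) \<in> ?E" for x y
  proof -
    from xy have "x \<in> ?Z" "y \<in> ?Z" and b: "x - y \<in> d ` C (n - 1)"
      by (auto simp: cohomologous_def)
    moreover have "\<phi> (x - y) \<in> d' ` C' (n - 1)"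
      using b \<phi>_boundary by auto
    moreover from calculation have "\<phi> (x - y) = \<phi> x - \<phi> y"
      by (intro \<phi>_diff) (simp_all add: cocycles_def)
    ultimately show ?thesis
      by (simp add: cohomologous_def \<phi>_cocycle)
  qed
  \<comment> \<open>A class is sent to the union of the classes of all images of its elements. By
    \<open>resp\<close> these classes coincide, so one representative suffices.\<close>
  have map_class: "?E' `` (\<phi> ` (?E `` {x})) = ?E' `` {\<phi> x}" if "x \<in> ?Z" for x
  proof
    show "?E' `` (\<phi> ` (?E `` {x})) \<subseteq> ?E' `` {\<phi> x}"
      using resp E' by (fastforce elim: equivE dest: transD)
    show "?E' `` {\<phi> x} \<subseteq> ?E' `` (\<phi> ` (?E `` {x}))"
      using equiv_class_self[OF E that] by auto
  qed
  have class_eq: "?E' `` {\<phi> x} = ?E' `` {\<phi> y} \<longleftrightarrow> \<phi> x - \<phi> y \<in> d' ` C' (n - 1)"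
    if "x \<in> ?Z" "y \<in> ?Z" for x y
    using eq_equiv_class_iff[OF E' \<phi>_cocycle[OF that(1)] \<phi>_cocycle[OF that(2)]] that \<phi>_cocycle
    by (auto simp: cohomologous_def)
  have inj: "inj_on (\<lambda>c. ?E' `` (\<phi> ` c)) (?Z // ?E) \<longleftrightarrow> ?inj"
  proof
    assume i: "inj_on (\<lambda>c. ?E' `` (\<phi> ` c)) (?Z // ?E)"
    show ?inj
    proof (intro ballI impI)
      fix x assume x: "x \<in> ?Z" and b: "\<phi> x \<in> d' ` C' (n - 1)"
      \<comment> \<open>Triviality of the kernel is injectivity tested against the class of
        \<open>0\<close>, which is a cocycle mapped to \<open>0\<close>.\<close>
      have d0: "d 0 = 0" using d_diff(1)[OF zero(1) zero(1)] by simp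
      then have z: "0 \<in> ?Z" using zero by (simp add: cocycles_def)
      have "\<phi> 0 = 0" using \<phi>_diff[OF zero(1) zero(1)] by simp
      then have "?E' `` (\<phi> ` (?E `` {x})) = ?E' `` (\<phi> ` (?E `` {0}))"
        using b class_eq[OF x z] by (simp add: map_class[OF x] map_class[OF z])
      then have "?E `` {x} = ?E `` {0}"
        by (rule inj_onD[OF i _ quotientI[OF x] quotientI[OF z]])
      then show "x \<in> d ` C (n - 1)"
        using eq_equiv_class_iff[OF E x z] by (simp add: cohomologous_def)
    qed
  next
    assume i: ?inj
    show "inj_on (\<lambda>c. ?E' `` (\<phi> ` c)) (?Z // ?E)"
    proof (rule inj_onI)
      fix c c' assume c: "c \<in> ?Z // ?E" "c' \<in> ?Z // ?E" and eq: "?E' `` (\<phi> ` c) = ?E' `` (\<phi> ` c')"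
      obtain x y where x: "x \<in> ?Z" "c = ?E `` {x}" and y: "y \<in> ?Z" "c' = ?E `` {y}"
        using c by (metis quotientE)
      have xy: "x \<in> C n" "y \<in> C n" "d x = 0" "d y = 0"
        using x y by (auto simp: cocycles_def)
      then have "x - y \<in> ?Z" using diff d_diff by (simp add: cocycles_def)
      moreover have "\<phi> (x - y) \<in> d' ` C' (n - 1)"
        using eq unfolding x(2) y(2) map_class[OF x(1)] map_class[OF y(1)] class_eq[OF x(1) y(1)]
        by (simp only: \<phi>_diff xy)
      ultimately have "x - y \<in> d ` C (n - 1)" using i by blast
      then show "c = c'"
        using x y eq_equiv_class_iff[OF E x(1) y(1)] by (simp add: cohomologous_def)
    qed
  qed
  have sub: "(\<lambda>c. ?E' `` (\<phi> ` c)) ` (?Z // ?E) \<subseteq> ?Z' // ?E'"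
  proof (rule image_subsetI)
    fix c assume "c \<in> ?Z // ?E"
    then obtain x where x: "x \<in> ?Z" "c = ?E `` {x}" by (rule quotientE)
    then show "?E' `` (\<phi> ` c) \<in> ?Z' // ?E'"
      unfolding x(2) map_class[OF x(1)] by (intro quotientI \<phi>_cocycle)
  qed
  have surj: "?Z' // ?E' \<subseteq> (\<lambda>c. ?E' `` (\<phi> ` c)) ` (?Z // ?E) \<longleftrightarrow> ?surj"
  proof
    assume s: "?Z' // ?E' \<subseteq> (\<lambda>c. ?E' `` (\<phi> ` c)) ` (?Z // ?E)"
    show ?surj
    proof
      fix y assume y: "y \<in> ?Z'"
      obtain c where c: "c \<in> ?Z // ?E" and yc: "?E' `` {y} = ?E' `` (\<phi> ` c)"
        using subsetD[OF s quotientI[OF y]] by (rule imageE)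
      from c obtain x where x: "x \<in> ?Z" and cx: "c = ?E `` {x}" by (rule quotientE)
      have "?E' `` {y} = ?E' `` {\<phi> x}" using yc unfolding cx map_class[OF x] .
      then have "(y, \<phi> x) \<in> ?E'"
        using eq_equiv_class_iff[OF E' y \<phi>_cocycle[OF x]] by blast
      then show "\<exists>x \<in> ?Z. y - \<phi> x \<in> d' ` C' (n - 1)"
        using x by (auto simp: cohomologous_def)
    qed
  next
    assume s: ?surj
    show "?Z' // ?E' \<subseteq> (\<lambda>c. ?E' `` (\<phi> ` c)) ` (?Z // ?E)"
    proof
      fix c assume "c \<in> ?Z' // ?E'"
      then obtain y where y: "y \<in> ?Z'" "c = ?E' `` {y}" by (rule quotientE)
      then obtain x where x: "x \<in> ?Z" "y - \<phi> x \<in> d' ` C' (n - 1)" using s by blast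
      then have "c = ?E' `` (\<phi> ` (?E `` {x}))"
        unfolding map_class[OF x(1)] y(2)
        using x y(1) by (intro equiv_class_eq[OF E']) (simp add: cohomologous_def \<phi>_cocycle)
      then show "c \<in> (\<lambda>c. ?E' `` (\<phi> ` c)) ` (?Z // ?E)"
        using quotientI[OF x(1)] by blast
    qed
  qed
  show ?thesis
    unfolding iso_on_cohomology_def cohomology_def bij_betw_def set_eq_subset inj[symmetric] surj[symmetric]
    using sub by (simp only: simp_thms)
qed

section \<open>Calculus in a dg category\<close>

lemma koszul_simps [simp]: "koszul 0 x = x" "koszul (-1) x = - x" "koszul (-2) x = x" "koszul n 0 = 0"
  by (simp_all add: koszul_def)

lemma koszul_diff: "koszul n (x - y) = koszul n x - koszul n (y::'a::ab_group_add)"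
  by (simp add: koszul_def)

lemma koszul_koszul [simp]: "koszul n (koszul n x) = (x::'a::ab_group_add)"
  by (simp add: koszul_def)

lemma koszul_minus: "koszul n (- x) = - koszul n (x::'a::ab_group_add)"
  by (simp add: koszul_def)

text \<open>Hom modules overlap (all contain \<open>0\<close>), so source, target and degree cannot
  be recovered from an element. Bundling them with the membership of both objects gives each rule of
  the calculus one premise per morphism.\<close>

definition arr :: "('o, 'm::ab_group_add, 'k) dg_cat \<Rightarrow> 'o \<Rightarrow> 'o \<Rightarrow> int \<Rightarrow> 'm \<Rightarrow> bool" where
  "arr A X Y n f \<longleftrightarrow> X \<in> Obj A \<and> Y \<in> Obj A \<and> f \<in> Hom A X Y n"

lemma arr_obj: "arr A X Y n f \<Longrightarrow> X \<in> Obj A" "arr A X Y n f \<Longrightarrow> Y \<in> Obj A"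
  by (simp_all add: arr_def)

context dg_category
begin

lemma arr_zero: "X \<in> Obj A \<Longrightarrow> Y \<in> Obj A \<Longrightarrow> arr A X Y n 0"
  using module.subspace_0[OF smul_module Hom_subspace] by (simp add: arr_def)

lemma arr_idn: "X \<in> Obj A \<Longrightarrow> arr A X X 0 (idn A X)"
  by (simp add: arr_def idn_closed)

lemma arr_add: "arr A X Y n f \<Longrightarrow> arr A X Y n g \<Longrightarrow> arr A X Y n (f + g)"
  using module.subspace_add[OF smul_module Hom_subspace] by (simp add: arr_def)

lemma arr_diff: "arr A X Y n f \<Longrightarrow> arr A X Y n g \<Longrightarrow> arr A X Y n (f - g)"
  using module.subspace_diff[OF smul_module Hom_subspace] by (simp add: arr_def)

lemma arr_minus: "arr A X Y n f \<Longrightarrow> arr A X Y n (- f)"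
  using module.subspace_neg[OF smul_module Hom_subspace] by (simp add: arr_def)

lemma arr_koszul: "arr A X Y n f \<Longrightarrow> arr A X Y n (koszul m f)"
  by (simp add: koszul_def arr_minus)

text \<open>The degree is a variable with an equation, so that the rule also yields degrees in
  another normal form, such as \<open>n - 1\<close> for \<open>-1 + n\<close>.\<close>

lemma arr_cmp: "arr A Y Z n g \<Longrightarrow> arr A X Y m f \<Longrightarrow> k = n + m \<Longrightarrow> arr A X Z k (g \<cdot> f)"
  unfolding arr_def by (elim conjE, intro conjI) (assumption | simp add: cmp_closed[of X Y Z])+

lemma arr_dif: "arr A X Y n f \<Longrightarrow> k = n + 1 \<Longrightarrow> arr A X Y k (\<d> f)"
  unfolding arr_def by (simp add: dif_closed)

lemma Z0_iff: "X \<in> Obj A \<Longrightarrow> Y \<in> Obj A \<Longrightarrow> f \<in> Z0 A X Y \<longleftrightarrow> arr A X Y 0 f \<and> \<d> f = 0"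
  by (simp add: arr_def Z0_def)

lemma add_cmp: "arr A Y Z n g \<Longrightarrow> arr A Y Z n g' \<Longrightarrow> arr A X Y m f \<Longrightarrow> (g + g') \<cdot> f = g \<cdot> f + g' \<cdot> f"
  unfolding arr_def by (elim conjE) (rule cmp_add_left)

lemma cmp_add: "arr A Y Z n g \<Longrightarrow> arr A X Y m f \<Longrightarrow> arr A X Y m f' \<Longrightarrow> g \<cdot> (f + f') = g \<cdot> f + g \<cdot> f'"
  unfolding arr_def by (elim conjE) (rule cmp_add_right)

text \<open>Follows from additivity since \<open>g = (g - g') + g'\<close>. Zero then comes from
  \<open>0 = 0 - 0\<close> and negation from \<open>- g = 0 - g\<close>.\<close>

lemma diff_cmp: "arr A Y Z n g \<Longrightarrow> arr A Y Z n g' \<Longrightarrow> arr A X Y m f \<Longrightarrow> (g - g') \<cdot> f = g \<cdot> f - g' \<cdot> f"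
  using add_cmp[OF arr_diff, of Y Z n g g' g' X m f] by (simp add: eq_diff_eq)

lemma cmp_diff: "arr A Y Z n g \<Longrightarrow> arr A X Y m f \<Longrightarrow> arr A X Y m f' \<Longrightarrow> g \<cdot> (f - f') = g \<cdot> f - g \<cdot> f'"
  using cmp_add[OF _ arr_diff, of Y Z n g X m f f' f'] by (simp add: eq_diff_eq)

lemma zero_cmp: "arr A X Y m f \<Longrightarrow> Z \<in> Obj A \<Longrightarrow> 0 \<cdot> f = 0"
  using diff_cmp[OF arr_zero arr_zero, where f = f and Y = Y and Z = Z and X = X and m = m]
  by (simp add: arr_def)

lemma cmp_zero: "arr A Y Z n g \<Longrightarrow> X \<in> Obj A \<Longrightarrow> g \<cdot> 0 = 0"
  using cmp_diff[OF _ arr_zero arr_zero, of Y Z n g X] by (simp add: arr_def)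

lemma minus_cmp: "arr A Y Z n g \<Longrightarrow> arr A X Y m f \<Longrightarrow> (- g) \<cdot> f = - (g \<cdot> f)"
  using diff_cmp[OF arr_zero, of Y Z n g X m f] zero_cmp[of X Y m f Z] by (simp add: arr_def)

lemma cmp_minus: "arr A Y Z n g \<Longrightarrow> arr A X Y m f \<Longrightarrow> g \<cdot> (- f) = - (g \<cdot> f)"
  using cmp_diff[OF _ arr_zero, of Y Z n g X m f] cmp_zero[of Y Z n g X] by (simp add: arr_def)

lemma cmp_assoc_arr:
  "arr A Y Z n h \<Longrightarrow> arr A X Y m g \<Longrightarrow> arr A W X l f \<Longrightarrow> (h \<cdot> g) \<cdot> f = h \<cdot> (g \<cdot> f)"
  unfolding arr_def by (elim conjE) (rule cmp_assoc)

lemma idn_cmp: "arr A X Y n f \<Longrightarrow> idn A Y \<cdot> f = f"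
  unfolding arr_def by (elim conjE) (rule idn_left)

lemma cmp_idn: "arr A X Y n f \<Longrightarrow> f \<cdot> idn A X = f"
  unfolding arr_def by (elim conjE) (rule idn_right)

lemma dif_add_arr: "arr A X Y n f \<Longrightarrow> arr A X Y n g \<Longrightarrow> \<d> (f + g) = \<d> f + \<d> g"
  unfolding arr_def by (elim conjE) (rule dif_add)

lemma dif_diff: "arr A X Y n f \<Longrightarrow> arr A X Y n g \<Longrightarrow> \<d> (f - g) = \<d> f - \<d> g"
  using dif_add_arr[OF arr_diff, of X Y n f g g] by (simp add: eq_diff_eq)

lemma dif_zero: "X \<in> Obj A \<Longrightarrow> Y \<in> Obj A \<Longrightarrow> \<d> 0 = 0"
  using dif_diff[OF arr_zero arr_zero, of X Y] by simp

lemma dif_minus: "arr A X Y n f \<Longrightarrow> \<d> (- f) = - \<d> f"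
  using dif_diff[OF arr_zero, of X Y n f] dif_zero[of X Y] by (simp add: arr_def)

lemma dif_koszul: "arr A X Y n f \<Longrightarrow> \<d> (koszul i f) = koszul i (\<d> f)"
  using dif_minus by (simp add: koszul_def)

lemma dif_dif_arr: "arr A X Y n f \<Longrightarrow> \<d> (\<d> f) = 0"
  unfolding arr_def by (elim conjE) (rule dif_dif)

lemma dif_cmp: "arr A Y Z n g \<Longrightarrow> arr A X Y m f \<Longrightarrow> \<d> (g \<cdot> f) = \<d> g \<cdot> f + koszul n (g \<cdot> \<d> f)"
  unfolding arr_def by (elim conjE) (rule leibniz)

lemma dif_cmp_closed_left:
  "arr A Y Z n g \<Longrightarrow> arr A X Y m f \<Longrightarrow> \<d> g = 0 \<Longrightarrow> \<d> (g \<cdot> f) = koszul n (g \<cdot> \<d> f)"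
  by (simp add: dif_cmp zero_cmp[OF _ arr_obj(2)])

lemma dif_cmp_closed_right:
  "arr A Y Z n g \<Longrightarrow> arr A X Y m f \<Longrightarrow> \<d> f = 0 \<Longrightarrow> \<d> (g \<cdot> f) = \<d> g \<cdot> f"
  by (simp add: dif_cmp cmp_zero[OF _ arr_obj(1)])

end

section \<open>Elementwise exactness\<close>

text \<open>The conjuncts are injectivity and surjectivity on cohomology of degree \<open>n\<close>.
  A pair of degrees \<open>n - 1\<close> and \<open>n - 2\<close> is a cochain of degree
  \<open>n - 1\<close> in the cone-like complex of \<open>map_j X\<close>, and the condition on
  \<open>dif A w\<close> is the second component of the cocycle condition.\<close>

definition left_exact_at ::
  "('o, 'm::ab_group_add, 'k) dg_cat \<Rightarrow> ('o, 'm) three_term \<Rightarrow> 'o \<Rightarrow> int \<Rightarrow> bool" where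
  "left_exact_at A X Y n \<longleftrightarrow>
    (\<forall>u v w. arr A Y (ob0 X) n u \<and> dif A u = 0 \<and>
      arr A Y (ob1 X) (n - 1) v \<and> arr A Y (ob2 X) (n - 2) w \<and>
      map_f X \<cdot>\<^bsub>A\<^esub> u = dif A v \<and> map_h X \<cdot>\<^bsub>A\<^esub> u = - dif A w - map_j X \<cdot>\<^bsub>A\<^esub> v \<longrightarrow>
      (\<exists>u'. arr A Y (ob0 X) (n - 1) u' \<and> u = dif A u')) \<and>
    (\<forall>v w. arr A Y (ob1 X) n v \<and> dif A v = 0 \<and>
      arr A Y (ob2 X) (n - 1) w \<and> dif A w = - (map_j X \<cdot>\<^bsub>A\<^esub> v) \<longrightarrow>
      (\<exists>u v' w'. arr A Y (ob0 X) n u \<and> dif A u = 0 \<and>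
        arr A Y (ob1 X) (n - 1) v' \<and> arr A Y (ob2 X) (n - 2) w' \<and>
        v - map_f X \<cdot>\<^bsub>A\<^esub> u = dif A v' \<and> w - map_h X \<cdot>\<^bsub>A\<^esub> u = - dif A w' - map_j X \<cdot>\<^bsub>A\<^esub> v'))"

definition right_exact_at ::
  "('o, 'm::ab_group_add, 'k) dg_cat \<Rightarrow> ('o, 'm) three_term \<Rightarrow> 'o \<Rightarrow> int \<Rightarrow> bool" where
  "right_exact_at A X Y n \<longleftrightarrow>
    (\<forall>u v w. arr A (ob2 X) Y n u \<and> dif A u = 0 \<and>
      arr A (ob1 X) Y (n - 1) v \<and> arr A (ob0 X) Y (n - 2) w \<and>
      u \<cdot>\<^bsub>A\<^esub> map_j X = dif A v \<and> koszul n (u \<cdot>\<^bsub>A\<^esub> map_h X) = - dif A w - v \<cdot>\<^bsub>A\<^esub> map_f X \<longrightarrow>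
      (\<exists>u'. arr A (ob2 X) Y (n - 1) u' \<and> u = dif A u')) \<and>
    (\<forall>v w. arr A (ob1 X) Y n v \<and> dif A v = 0 \<and>
      arr A (ob0 X) Y (n - 1) w \<and> dif A w = - (v \<cdot>\<^bsub>A\<^esub> map_f X) \<longrightarrow>
      (\<exists>u v' w'. arr A (ob2 X) Y n u \<and> dif A u = 0 \<and>
        arr A (ob1 X) Y (n - 1) v' \<and> arr A (ob0 X) Y (n - 2) w' \<and>
        v - u \<cdot>\<^bsub>A\<^esub> map_j X = dif A v' \<and>
        w - koszul n (u \<cdot>\<^bsub>A\<^esub> map_h X) = - dif A w' - v' \<cdot>\<^bsub>A\<^esub> map_f X))"

context dg_category
begin

lemma h_complex_arr:
  assumes "h_complex A X"
  shows "arr A (ob0 X) (ob1 X) 0 (map_f X)" "arr A (ob1 X) (ob2 X) 0 (map_j X)"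
    "arr A (ob0 X) (ob2 X) (-1) (map_h X)" "\<d> (map_f X) = 0" "\<d> (map_j X) = 0"
    "\<d> (map_h X) = - (map_j X \<cdot> map_f X)"
  using assms by (simp_all add: h_complex_def arr_def Z0_def)

lemma h_left_exact_iff:
  "h_left_exact A X \<longleftrightarrow> h_complex A X \<and> (\<forall>Y \<in> Obj A. \<forall>n \<le> 0. left_exact_at A X Y n)"
proof -
  let ?f = "map_f X" and ?j = "map_j X" and ?h = "map_h X"
  have "iso_on_cohomology (\<lambda>i. Hom A Y (ob0 X) i) (dif A)
      (\<lambda>i. Hom A Y (ob1 X) i \<times> Hom A Y (ob2 X) (i - 1)) (\<lambda>(v, w). (\<d> v, - \<d> w - ?j \<cdot> v))
      n (\<lambda>u. (?f \<cdot> u, ?h \<cdot> u)) \<longleftrightarrow> left_exact_at A X Y n"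
    if X: "h_complex A X" and Y: "Y \<in> Obj A" for Y n
  proof -
    note c = h_complex_arr[OF X]
    have ob: "ob0 X \<in> Obj A" "ob1 X \<in> Obj A" "ob2 X \<in> Obj A"
      using X by (simp_all add: h_complex_def)
    have hom0: "x \<in> Hom A Y (ob0 X) i \<longleftrightarrow> arr A Y (ob0 X) i x"
      and hom1: "x \<in> Hom A Y (ob1 X) i \<longleftrightarrow> arr A Y (ob1 X) i x"
      and hom2: "x \<in> Hom A Y (ob2 X) i \<longleftrightarrow> arr A Y (ob2 X) i x" for x i
      using ob Y by (simp_all add: arr_def)
    have cocycle: "\<d> (?f \<cdot> x) = 0 \<and> - \<d> (?h \<cdot> x) - ?j \<cdot> (?f \<cdot> x) = 0"
      if "arr A Y (ob0 X) n x" "\<d> x = 0" for x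
      using that c dif_cmp_closed_right[OF c(1) that] dif_cmp_closed_right[OF c(3) that]
        zero_cmp[OF that(1) ob(2)] minus_cmp[OF arr_cmp[OF c(2,1) refl] that(1)] cmp_assoc_arr[OF c(2,1) that(1)]
      by simp
    \<comment> \<open>Since \<open>map_h X\<close> has degree \<open>-1\<close>, the Leibniz rule
      reads d(hx) = -jfx - h(dx). So the image of dx is the differential of (fx, hx), and the same
      formula with dx = 0 gives \<open>cocycle\<close>.\<close>
    have boundary: "?f \<cdot> \<d> x = \<d> (?f \<cdot> x) \<and> ?h \<cdot> \<d> x = - \<d> (?h \<cdot> x) - ?j \<cdot> (?f \<cdot> x)"
      if "arr A Y (ob0 X) (n - 1) x" for x
      using dif_cmp_closed_left[OF c(1) that c(4)] dif_cmp[OF c(3) that]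
        minus_cmp[OF arr_cmp[OF c(2,1) refl] that(1)] cmp_assoc_arr[OF c(2,1) that(1)] c(6)
      by simp
    have cocycle_iff: "- \<d> x = y \<longleftrightarrow> \<d> x = - y" for x y
      by (rule minus_equation_iff[of "\<d> x" y, simplified eq_commute[of _ "\<d> x"]])
    show ?thesis
      apply (subst iso_on_cohomology_iff)
      subgoal using ob Y by (simp add: hom0 arr_zero)
      subgoal using ob Y by (simp add: hom0 arr_zero)
      subgoal by (simp add: hom0 arr_diff)
      subgoal by (simp add: hom0 arr_diff)
      subgoal by (simp add: hom0 dif_diff)
      subgoal by (simp add: hom0 dif_diff)
      subgoal using ob Y by (simp add: hom1 hom2 arr_zero zero_prod_def)
      subgoal using ob Y by (simp add: hom1 hom2 arr_zero zero_prod_def)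
      subgoal by (auto simp: hom1 hom2 arr_diff)
      subgoal by (auto simp: hom1 hom2 arr_diff)
      subgoal by (auto simp: hom1 hom2 dif_diff cmp_diff[OF c(2)])
      subgoal by (simp add: hom0 cmp_diff[OF c(1)] cmp_diff[OF c(3)])
      subgoal using cocycle by (auto simp: cocycles_def hom0 hom1 hom2 arr_cmp[OF c(1)] arr_cmp[OF c(3)] zero_prod_def)
      subgoal for x
        using boundary[of x]
        by (auto simp: hom0 hom1 hom2 arr_cmp[OF c(1)] arr_cmp[OF c(3)]
            intro!: image_eqI[where x = "(?f \<cdot> x, ?h \<cdot> x)"])
      subgoal
        unfolding left_exact_at_def cocycles_def
        by (simp add: image_iff Bex_def hom0 hom1 hom2 zero_prod_def cocycle_iff, intro conj_cong; blast)
      done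
  qed
  then show ?thesis
    unfolding h_left_exact_def by blast
qed

lemma h_right_exact_iff:
  "h_right_exact A X \<longleftrightarrow> h_complex A X \<and> (\<forall>Y \<in> Obj A. \<forall>n \<le> 0. right_exact_at A X Y n)"
proof -
  let ?f = "map_f X" and ?j = "map_j X" and ?h = "map_h X"
  have "iso_on_cohomology (\<lambda>i. Hom A (ob2 X) Y i) (dif A)
      (\<lambda>i. Hom A (ob1 X) Y i \<times> Hom A (ob0 X) Y (i - 1)) (\<lambda>(v, w). (\<d> v, - \<d> w - v \<cdot> ?f))
      n (\<lambda>u. (u \<cdot> ?j, koszul n (u \<cdot> ?h))) \<longleftrightarrow> right_exact_at A X Y n"
    if X: "h_complex A X" and Y: "Y \<in> Obj A" for Y n
  proof -
    note c = h_complex_arr[OF X]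
    have ob: "ob0 X \<in> Obj A" "ob1 X \<in> Obj A" "ob2 X \<in> Obj A"
      using X by (simp_all add: h_complex_def)
    have hom0: "x \<in> Hom A (ob0 X) Y i \<longleftrightarrow> arr A (ob0 X) Y i x"
      and hom1: "x \<in> Hom A (ob1 X) Y i \<longleftrightarrow> arr A (ob1 X) Y i x"
      and hom2: "x \<in> Hom A (ob2 X) Y i \<longleftrightarrow> arr A (ob2 X) Y i x" for x i
      using ob Y by (simp_all add: arr_def)
    have pred: "koszul (n - 1) x = - koszul n x" for x :: 'm
      by (simp add: koszul_def)
    have cocycle: "\<d> (x \<cdot> ?j) = 0 \<and> - \<d> (koszul n (x \<cdot> ?h)) - (x \<cdot> ?j) \<cdot> ?f = 0"
      if x: "arr A (ob2 X) Y n x" "\<d> x = 0" for x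
      using c(5,6) dif_cmp_closed_left[OF x(1) c(2) x(2)] dif_cmp_closed_left[OF x(1) c(3) x(2)]
        cmp_zero[OF x(1) ob(2)] dif_koszul[OF arr_cmp[OF x(1) c(3) refl]]
        cmp_minus[OF x(1) arr_cmp[OF c(2,1) refl]] cmp_assoc_arr[OF x(1) c(2,1)]
      by (simp add: koszul_minus)
    \<comment> \<open>The primitive lies in degree \<open>n - 1\<close> and carries the sign of that
      degree, opposite to \<open>koszul n\<close>. This is what makes the term from d(h) = -jf come
      out as \<open>(x \<cdot> ?j) \<cdot> ?f\<close> with coefficient -1.\<close>
    have boundary: "\<d> x \<cdot> ?j = \<d> (x \<cdot> ?j) \<and>
        koszul n (\<d> x \<cdot> ?h) = - \<d> (koszul (n - 1) (x \<cdot> ?h)) - (x \<cdot> ?j) \<cdot> ?f"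
      if x: "arr A (ob2 X) Y (n - 1) x" for x
      using c(6) dif_cmp_closed_right[OF x c(2) c(5)] dif_cmp[OF x c(3)]
        dif_koszul[OF arr_cmp[OF x c(3) refl], of "n - 1"]
        cmp_minus[OF x arr_cmp[OF c(2,1) refl]] cmp_assoc_arr[OF x c(2,1)]
      by (simp add: pred koszul_def)
    have cocycle_iff: "- \<d> x = y \<longleftrightarrow> \<d> x = - y" for x y
      by (rule minus_equation_iff[of "\<d> x" y, simplified eq_commute[of _ "\<d> x"]])
    show ?thesis
      apply (subst iso_on_cohomology_iff)
      subgoal using ob Y by (simp add: hom2 arr_zero)
      subgoal using ob Y by (simp add: hom2 arr_zero)
      subgoal by (simp add: hom2 arr_diff)
      subgoal by (simp add: hom2 arr_diff)
      subgoal by (simp add: hom2 dif_diff)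
      subgoal by (simp add: hom2 dif_diff)
      subgoal using ob Y by (simp add: hom1 hom0 arr_zero zero_prod_def)
      subgoal using ob Y by (simp add: hom1 hom0 arr_zero zero_prod_def)
      subgoal by (auto simp: hom1 hom0 arr_diff)
      subgoal by (auto simp: hom1 hom0 arr_diff)
      subgoal by (auto simp: hom1 hom0 dif_diff diff_cmp[OF _ _ c(1)])
      subgoal by (simp add: hom2 diff_cmp[OF _ _ c(2)] diff_cmp[OF _ _ c(3)] koszul_diff)
      subgoal using cocycle
        by (auto simp: cocycles_def hom0 hom1 hom2 arr_cmp[OF _ c(2)] arr_koszul arr_cmp[OF _ c(3)] zero_prod_def)
      subgoal for x
        using boundary[of x]
        by (auto simp: hom0 hom1 hom2 arr_cmp[OF _ c(2)] arr_koszul arr_cmp[OF _ c(3)]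
            intro!: image_eqI[where x = "(x \<cdot> ?j, koszul (n - 1) (x \<cdot> ?h))"])
      subgoal
        unfolding right_exact_at_def cocycles_def
        by (simp add: image_iff Bex_def hom0 hom1 hom2 zero_prod_def cocycle_iff, intro conj_cong; blast)
      done
  qed
  then show ?thesis
    unfolding h_right_exact_def by blast
qed

end

section \<open>Invariance of homotopy exactness\<close>

context dg_category
begin

lemma h_morphism_arr:
  assumes "h_complex A X" "h_complex A X'" "h_morphism A X X' m"
  shows "arr A (ob0 X) (ob0 X') 0 (r0 m)" "arr A (ob1 X) (ob1 X') 0 (r1 m)"
    "arr A (ob2 X) (ob2 X') 0 (r2 m)" "arr A (ob0 X) (ob1 X') (-1) (s1 m)"
    "arr A (ob1 X) (ob2 X') (-1) (s2 m)" "arr A (ob0 X) (ob2 X') (-2) (tt m)"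
    "\<d> (r0 m) = 0" "\<d> (r1 m) = 0" "\<d> (r2 m) = 0"
    "\<d> (s1 m) = map_f X' \<cdot> r0 m - r1 m \<cdot> map_f X"
    "\<d> (s2 m) = map_j X' \<cdot> r1 m - r2 m \<cdot> map_j X"
    "\<d> (tt m) = r2 m \<cdot> map_h X - map_h X' \<cdot> r0 m - s2 m \<cdot> map_f X - map_j X' \<cdot> s1 m"
  using assms by (simp_all add: h_complex_def h_morphism_def arr_def Z0_def)

text \<open>The chain map that a 6-tuple induces on the cones of the maps \<open>map_j\<close>.\<close>

lemma h_morphism_cone:
  assumes X: "h_complex A X" "h_complex A X'" and m: "h_morphism A X X' m"
    and v: "arr A Y (ob1 X) n v" and w: "arr A Y (ob2 X) (n - 1) w"
  shows "\<d> (r1 m \<cdot> v) = r1 m \<cdot> \<d> v"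
    and "- \<d> (r2 m \<cdot> w - s2 m \<cdot> v) - map_j X' \<cdot> (r1 m \<cdot> v) = r2 m \<cdot> (- \<d> w - map_j X \<cdot> v) - s2 m \<cdot> \<d> v"
proof -
  note c = h_complex_arr[OF X(1)] note c' = h_complex_arr[OF X(2)] note m = h_morphism_arr[OF X m]
  show "\<d> (r1 m \<cdot> v) = r1 m \<cdot> \<d> v"
    using dif_cmp_closed_left[OF m(2) v m(8)] by simp
  have jv: "arr A Y (ob2 X) n (map_j X \<cdot> v)" and dw: "arr A Y (ob2 X) n (\<d> w)"
    using arr_cmp[OF c(2) v] arr_dif[OF w] by simp_all
  have "\<d> (r2 m \<cdot> w - s2 m \<cdot> v) = \<d> (r2 m \<cdot> w) - \<d> (s2 m \<cdot> v)"
    by (rule dif_diff[OF arr_cmp[OF m(3) w refl] arr_cmp[OF m(5) v]]) simp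
  also have "\<d> (r2 m \<cdot> w) = r2 m \<cdot> \<d> w"
    using dif_cmp_closed_left[OF m(3) w m(9)] by simp
  also have "\<d> (s2 m \<cdot> v) = map_j X' \<cdot> (r1 m \<cdot> v) - r2 m \<cdot> (map_j X \<cdot> v) - s2 m \<cdot> \<d> v"
    using dif_cmp[OF m(5) v] diff_cmp[OF arr_cmp[OF c'(2) m(2) refl] arr_cmp[OF m(3) c(2) refl] v]
      cmp_assoc_arr[OF c'(2) m(2) v] cmp_assoc_arr[OF m(3) c(2) v] by (simp add: m(11))
  finally show "- \<d> (r2 m \<cdot> w - s2 m \<cdot> v) - map_j X' \<cdot> (r1 m \<cdot> v) = r2 m \<cdot> (- \<d> w - map_j X \<cdot> v) - s2 m \<cdot> \<d> v"
    using cmp_diff[OF m(3) arr_minus[OF dw] jv] cmp_minus[OF m(3) dw] by simp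
qed

text \<open>The comparison maps u \<mapsto> (fu, hu) of \<open>X\<close> and \<open>X'\<close>
  commute with the chain maps induced by \<open>m\<close> only up to homotopy. The pair
  \<open>(s1 m \<cdot> u, tt m \<cdot> u)\<close> is that homotopy: the two equations are the
  components of its differential in the cone. For cocycles \<open>u\<close> no further term
  occurs.\<close>

lemma h_morphism_square:
  assumes X: "h_complex A X" "h_complex A X'" and m: "h_morphism A X X' m"
    and u: "arr A Y (ob0 X) n u" "\<d> u = 0"
  shows "map_f X' \<cdot> (r0 m \<cdot> u) = r1 m \<cdot> (map_f X \<cdot> u) + \<d> (s1 m \<cdot> u)"
    and "map_h X' \<cdot> (r0 m \<cdot> u) =
      r2 m \<cdot> (map_h X \<cdot> u) - s2 m \<cdot> (map_f X \<cdot> u) - \<d> (tt m \<cdot> u) - map_j X' \<cdot> (s1 m \<cdot> u)"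
proof -
  note c = h_complex_arr[OF X(1)] note c' = h_complex_arr[OF X(2)] note m = h_morphism_arr[OF X m]
  show "map_f X' \<cdot> (r0 m \<cdot> u) = r1 m \<cdot> (map_f X \<cdot> u) + \<d> (s1 m \<cdot> u)"
    using dif_cmp_closed_right[OF m(4) u] diff_cmp[OF arr_cmp[OF c'(1) m(1) refl] arr_cmp[OF m(2) c(1) refl] u(1)]
      cmp_assoc_arr[OF c'(1) m(1) u(1)] cmp_assoc_arr[OF m(2) c(1) u(1)] by (simp add: m(10))
  have t: "arr A (ob0 X) (ob2 X') (-1) (r2 m \<cdot> map_h X)" "arr A (ob0 X) (ob2 X') (-1) (map_h X' \<cdot> r0 m)"
    "arr A (ob0 X) (ob2 X') (-1) (s2 m \<cdot> map_f X)" "arr A (ob0 X) (ob2 X') (-1) (map_j X' \<cdot> s1 m)"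
    using arr_cmp[OF m(3) c(3)] arr_cmp[OF c'(3) m(1)] arr_cmp[OF m(5) c(1)] arr_cmp[OF c'(2) m(4)] by simp_all
  show "map_h X' \<cdot> (r0 m \<cdot> u) =
      r2 m \<cdot> (map_h X \<cdot> u) - s2 m \<cdot> (map_f X \<cdot> u) - \<d> (tt m \<cdot> u) - map_j X' \<cdot> (s1 m \<cdot> u)"
    using dif_cmp_closed_right[OF m(6) u] diff_cmp[OF arr_diff[OF arr_diff[OF t(1,2)] t(3)] t(4) u(1)]
      diff_cmp[OF arr_diff[OF t(1,2)] t(3) u(1)] diff_cmp[OF t(1,2) u(1)]
      cmp_assoc_arr[OF m(3) c(3) u(1)] cmp_assoc_arr[OF c'(3) m(1) u(1)]
      cmp_assoc_arr[OF m(5) c(1) u(1)] cmp_assoc_arr[OF c'(2) m(4) u(1)] by (simp add: m(12))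
qed

text \<open>On cohomology: a retract of an isomorphism is an isomorphism.\<close>

lemma left_exact_at_retract:
  assumes X: "h_complex A X" "h_complex A X'"
    and m: "h_morphism A X X' m" and m': "h_morphism A X' X m'"
    and hom: "h_homotopic A X' X' (h_comp A m m') (h_id A X')"
    and exact: "left_exact_at A X Y n"
  shows "left_exact_at A X' Y n"
proof -
  note c = h_complex_arr[OF X(1)] note c' = h_complex_arr[OF X(2)]
  note M = h_morphism_arr[OF X m] note M' = h_morphism_arr[OF X(2,1) m']
  \<comment> \<open>The first of these components gives a homotopy on morphisms into
    \<open>ob0 X'\<close>, the other three one on the cone of \<open>map_j X'\<close>. Together they
    make the induced composites the identity on cohomology.\<close>
  obtain \<rho>0 \<rho>1 \<rho>2 \<sigma> where \<rho>: "arr A (ob0 X') (ob0 X') (-1) \<rho>0" "arr A (ob1 X') (ob1 X') (-1) \<rho>1"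
      "arr A (ob2 X') (ob2 X') (-1) \<rho>2" "arr A (ob1 X') (ob2 X') (-2) \<sigma>"
    and eq: "r0 m \<cdot> r0 m' - idn A (ob0 X') = \<d> \<rho>0" "r1 m \<cdot> r1 m' - idn A (ob1 X') = \<d> \<rho>1"
      "r2 m \<cdot> r2 m' - idn A (ob2 X') = \<d> \<rho>2"
      "r2 m \<cdot> s2 m' + s2 m \<cdot> r1 m' = \<d> \<sigma> + map_j X' \<cdot> \<rho>1 - \<rho>2 \<cdot> map_j X'"
    using hom X(2) by (auto simp: h_homotopic_def h_comp_def h_id_def h_complex_def arr_def)
  have obj: "ob0 X' \<in> Obj A" "ob1 X' \<in> Obj A" "ob2 X' \<in> Obj A"
    using X(2) by (simp_all add: h_complex_def)
  show ?thesis
    unfolding left_exact_at_def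
  proof (intro conjI allI impI)
    fix u v w
    assume H: "arr A Y (ob0 X') n u \<and> \<d> u = 0 \<and> arr A Y (ob1 X') (n - 1) v \<and>
      arr A Y (ob2 X') (n - 2) w \<and> map_f X' \<cdot> u = \<d> v \<and> map_h X' \<cdot> u = - \<d> w - map_j X' \<cdot> v"
    then have u: "arr A Y (ob0 X') n u" "\<d> u = 0" and v: "arr A Y (ob1 X') (n - 1) v"
      and w: "arr A Y (ob2 X') (n - 2) w" by simp_all
    \<comment> \<open>The cone is used in degree \<open>n - 1\<close> here, so its second component
      sits one degree lower.\<close>
    have w1: "arr A Y (ob2 X') (n - 1 - 1) w" using w by simp
    \<comment> \<open>The image of \<open>(v, w)\<close> under the cone map of \<open>m'\<close>,
      plus the homotopy \<open>(s1 m' \<cdot> u, tt m' \<cdot> u)\<close> of the comparison square: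
      a primitive of the image of \<open>r0 m' \<cdot> u\<close>.\<close>
    let ?v = "r1 m' \<cdot> v + s1 m' \<cdot> u" and ?w = "r2 m' \<cdot> w - s2 m' \<cdot> v + tt m' \<cdot> u"
    have t: "arr A Y (ob1 X) (n - 1) (r1 m' \<cdot> v)" "arr A Y (ob1 X) (n - 1) (s1 m' \<cdot> u)"
      "arr A Y (ob2 X) (n - 2) (r2 m' \<cdot> w)" "arr A Y (ob2 X) (n - 2) (s2 m' \<cdot> v)"
      "arr A Y (ob2 X) (n - 2) (tt m' \<cdot> u)" "arr A Y (ob0 X) n (r0 m' \<cdot> u)"
      using arr_cmp[OF M'(2) v] arr_cmp[OF M'(4) u(1)] arr_cmp[OF M'(3) w] arr_cmp[OF M'(5) v]
        arr_cmp[OF M'(6) u(1)] arr_cmp[OF M'(1) u(1)] by simp_all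
    note t2 = arr_diff[OF t(3,4)]
    note sq = h_morphism_square[OF X(2,1) m' u]
    note cone = h_morphism_cone[OF X(2,1) m' v w1]
    have "map_f X \<cdot> (r0 m' \<cdot> u) = \<d> ?v"
      using sq(1) cone(1) H dif_add_arr[OF t(1,2)] by simp
    moreover have "map_h X \<cdot> (r0 m' \<cdot> u) = - \<d> ?w - map_j X \<cdot> ?v"
      using sq(2) cone(2) H dif_add_arr[OF t2 t(5)] cmp_add[OF c(2) t(1,2)] by (simp add: algebra_simps eq_neg_iff_add_eq_0)
    moreover have "\<d> (r0 m' \<cdot> u) = 0"
      using dif_cmp_closed_right[OF M'(1) u] M'(7) zero_cmp[OF u(1) arr_obj(2)[OF M'(1)]] by simp
    ultimately obtain x where x: "arr A Y (ob0 X) (n - 1) x" "r0 m' \<cdot> u = \<d> x"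
      using exact t(6) arr_add[OF t(1,2)] arr_add[OF t2 t(5)] unfolding left_exact_at_def by blast
    have t3: "arr A Y (ob0 X') (n - 1) (r0 m \<cdot> x)" "arr A Y (ob0 X') (n - 1) (\<rho>0 \<cdot> u)"
      using arr_cmp[OF M(1) x(1)] arr_cmp[OF \<rho>(1) u(1)] by simp_all
    have "r0 m \<cdot> (r0 m' \<cdot> u) - u = \<d> (\<rho>0 \<cdot> u)"
      using dif_cmp_closed_right[OF \<rho>(1) u] diff_cmp[OF arr_cmp[OF M(1) M'(1) refl] _ u(1)] arr_idn[OF obj(1)]
        cmp_assoc_arr[OF M(1) M'(1) u(1)] idn_cmp[OF u(1)] by (simp flip: eq(1))
    moreover have "r0 m \<cdot> (r0 m' \<cdot> u) = \<d> (r0 m \<cdot> x)"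
      using dif_cmp_closed_left[OF M(1) x(1) M(7)] x(2) by simp
    ultimately have "u = \<d> (r0 m \<cdot> x - \<rho>0 \<cdot> u)"
      using dif_diff[OF t3] by (simp add: algebra_simps)
    then show "\<exists>u'. arr A Y (ob0 X') (n - 1) u' \<and> u = \<d> u'"
      using arr_diff[OF t3] by blast
  next
    fix v w
    assume H: "arr A Y (ob1 X') n v \<and> \<d> v = 0 \<and> arr A Y (ob2 X') (n - 1) w \<and> \<d> w = - (map_j X' \<cdot> v)"
    then have v: "arr A Y (ob1 X') n v" "\<d> v = 0" and w: "arr A Y (ob2 X') (n - 1) w"
      and dw: "\<d> w = - (map_j X' \<cdot> v)" by simp_all
    \<comment> \<open>The cocycle \<open>(v, w)\<close> is moved to \<open>X\<close> by the cone map
      of \<open>m'\<close>, lifted there to some \<open>u\<close>, and the lift is moved back by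
      \<open>r0 m\<close>.\<close>
    let ?v = "r1 m' \<cdot> v" and ?w = "r2 m' \<cdot> w - s2 m' \<cdot> v"
    have t: "arr A Y (ob1 X) n ?v" "arr A Y (ob2 X) (n - 1) (r2 m' \<cdot> w)" "arr A Y (ob2 X) (n - 1) (s2 m' \<cdot> v)"
      using arr_cmp[OF M'(2) v(1)] arr_cmp[OF M'(3) w] arr_cmp[OF M'(5) v(1)] by simp_all
    note t2 = arr_diff[OF t(2,3)]
    note cone = h_morphism_cone[OF X(2,1) m' v(1) w]
    have "\<d> ?v = 0" "\<d> ?w = - (map_j X \<cdot> ?v)"
      using cone v(2) dw cmp_zero[OF M'(2) arr_obj(1)[OF v(1)]] cmp_zero[OF M'(3) arr_obj(1)[OF v(1)]]
        cmp_zero[OF M'(5) arr_obj(1)[OF v(1)]] by (simp_all, metis add.inverse_inverse)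
    then obtain u v1 w1 where u: "arr A Y (ob0 X) n u" "\<d> u = 0" and v1: "arr A Y (ob1 X) (n - 1) v1"
      and w1: "arr A Y (ob2 X) (n - 2) w1"
      and e1: "?v - map_f X \<cdot> u = \<d> v1" and e2: "?w - map_h X \<cdot> u = - \<d> w1 - map_j X \<cdot> v1"
      using exact t(1) t2 unfolding left_exact_at_def by blast
    have w1': "arr A Y (ob2 X) (n - 1 - 1) w1" using w1 by simp
    note sq = h_morphism_square[OF X m u]
    note cone1 = h_morphism_cone[OF X m v1 w1']
    have tX: "arr A Y (ob1 X) n (map_f X \<cdot> u)" "arr A Y (ob2 X) (n - 1) (map_h X \<cdot> u)"
      using arr_cmp[OF c(1) u(1)] arr_cmp[OF c(3) u(1)] by simp_all
    have t': "arr A Y (ob1 X') (n - 1) (\<rho>1 \<cdot> v)" "arr A Y (ob1 X') (n - 1) (r1 m \<cdot> v1)"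
      "arr A Y (ob1 X') (n - 1) (s1 m \<cdot> u)" "arr A Y (ob2 X') (n - 2) (\<rho>2 \<cdot> w)"
      "arr A Y (ob2 X') (n - 2) (\<sigma> \<cdot> v)" "arr A Y (ob2 X') (n - 2) (r2 m \<cdot> w1)"
      "arr A Y (ob2 X') (n - 2) (s2 m \<cdot> v1)" "arr A Y (ob2 X') (n - 2) (tt m \<cdot> u)"
      "arr A Y (ob0 X') n (r0 m \<cdot> u)"
      using arr_cmp[OF \<rho>(2) v(1)] arr_cmp[OF M(2) v1] arr_cmp[OF M(4) u(1)] arr_cmp[OF \<rho>(3) w]
        arr_cmp[OF \<rho>(4) v(1)] arr_cmp[OF M(3) w1] arr_cmp[OF M(5) v1] arr_cmp[OF M(6) u(1)]
        arr_cmp[OF M(1) u(1)] by simp_all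
    \<comment> \<open>Primitive of the remaining difference, with three contributions: the image of
      \<open>(v1, w1)\<close> under the cone map of \<open>m\<close>, minus the homotopy from the
      composite to the identity on \<open>(v, w)\<close>, minus the homotopy of the comparison
      square on \<open>u\<close>.\<close>
    let ?V = "r1 m \<cdot> v1 - \<rho>1 \<cdot> v - s1 m \<cdot> u"
    let ?W = "(r2 m \<cdot> w1 - s2 m \<cdot> v1) + (\<rho>2 \<cdot> w - \<sigma> \<cdot> v) - tt m \<cdot> u"
    \<comment> \<open>\<open>C1\<close> and \<open>C2\<close> are the two components of one fact:
      the composite of the cone maps moves \<open>(v, w)\<close> by the differential of
      \<open>(\<rho>1 \<cdot> v, \<sigma> \<cdot> v - \<rho>2 \<cdot> w)\<close>.\<close>
    have C1: "r1 m \<cdot> ?v - v = \<d> (\<rho>1 \<cdot> v)"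
      using dif_cmp_closed_right[OF \<rho>(2) v] diff_cmp[OF arr_cmp[OF M(2) M'(2) refl] _ v(1)] arr_idn[OF obj(2)]
        cmp_assoc_arr[OF M(2) M'(2) v(1)] idn_cmp[OF v(1)] by (simp flip: eq(2))
    have d\<rho>2: "r2 m \<cdot> (r2 m' \<cdot> w) - w = \<d> \<rho>2 \<cdot> w"
      using diff_cmp[OF arr_cmp[OF M(3) M'(3) refl] _ w] arr_idn[OF obj(3)]
        cmp_assoc_arr[OF M(3) M'(3) w] idn_cmp[OF w] by (simp flip: eq(3))
    have d\<rho>2': "\<d> (\<rho>2 \<cdot> w) = \<d> \<rho>2 \<cdot> w + \<rho>2 \<cdot> (map_j X' \<cdot> v)"
      using dif_cmp[OF \<rho>(3) w] dw cmp_minus[OF \<rho>(3) arr_cmp[OF c'(2) v(1) refl]] by simp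
    have ts: "arr A (ob1 X') (ob2 X') (-1) (r2 m \<cdot> s2 m')" "arr A (ob1 X') (ob2 X') (-1) (s2 m \<cdot> r1 m')"
      "arr A (ob1 X') (ob2 X') (-1) (\<d> \<sigma>)" "arr A (ob1 X') (ob2 X') (-1) (map_j X' \<cdot> \<rho>1)"
      "arr A (ob1 X') (ob2 X') (-1) (\<rho>2 \<cdot> map_j X')"
      using arr_cmp[OF M(3) M'(5)] arr_cmp[OF M(5) M'(2)] arr_dif[OF \<rho>(4)] arr_cmp[OF c'(2) \<rho>(2)]
        arr_cmp[OF \<rho>(3) c'(2)] by simp_all
    have "(r2 m \<cdot> s2 m' + s2 m \<cdot> r1 m') \<cdot> v = r2 m \<cdot> (s2 m' \<cdot> v) + s2 m \<cdot> ?v"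
      using add_cmp[OF ts(1,2) v(1)] cmp_assoc_arr[OF M(3) M'(5) v(1)] cmp_assoc_arr[OF M(5) M'(2) v(1)] by simp
    moreover have "(\<d> \<sigma> + map_j X' \<cdot> \<rho>1 - \<rho>2 \<cdot> map_j X') \<cdot> v =
        \<d> (\<sigma> \<cdot> v) + map_j X' \<cdot> (\<rho>1 \<cdot> v) - \<rho>2 \<cdot> (map_j X' \<cdot> v)"
      using diff_cmp[OF arr_add[OF ts(3,4)] ts(5) v(1)] add_cmp[OF ts(3,4) v(1)]
        dif_cmp_closed_right[OF \<rho>(4) v] cmp_assoc_arr[OF c'(2) \<rho>(2) v(1)] cmp_assoc_arr[OF \<rho>(3) c'(2) v(1)] by simp
    ultimately have s2v: "s2 m \<cdot> ?v = \<d> (\<sigma> \<cdot> v) + map_j X' \<cdot> (\<rho>1 \<cdot> v) - \<rho>2 \<cdot> (map_j X' \<cdot> v) - r2 m \<cdot> (s2 m' \<cdot> v)"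
      using eq(4) by (simp add: eq_diff_eq add.commute)
    have r2w: "r2 m \<cdot> (r2 m' \<cdot> w) = \<d> \<rho>2 \<cdot> w + w"
      using d\<rho>2 by (simp add: diff_eq_eq)
    have C2: "r2 m \<cdot> ?w - s2 m \<cdot> ?v - w = \<d> (\<rho>2 \<cdot> w - \<sigma> \<cdot> v) - map_j X' \<cdot> (\<rho>1 \<cdot> v)"
      unfolding cmp_diff[OF M(3) t(2,3)] dif_diff[OF t'(4,5)] s2v r2w d\<rho>2' by (simp add: algebra_simps)
    have "\<d> ?V = \<d> (r1 m \<cdot> v1) - \<d> (\<rho>1 \<cdot> v) - \<d> (s1 m \<cdot> u)"
      using dif_diff[OF arr_diff[OF t'(2,1)] t'(3)] dif_diff[OF t'(2,1)] by simp
    moreover have "\<d> (r1 m \<cdot> v1) = r1 m \<cdot> ?v - r1 m \<cdot> (map_f X \<cdot> u)"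
      using cone1(1) cmp_diff[OF M(2) t(1) tX(1)] by (simp flip: e1)
    ultimately have "v - map_f X' \<cdot> (r0 m \<cdot> u) = \<d> ?V"
      using C1 sq(1) by (simp add: algebra_simps)
    moreover have "w - map_h X' \<cdot> (r0 m \<cdot> u) = - \<d> ?W - map_j X' \<cdot> ?V"
    proof -
      have "\<d> ?W = \<d> (r2 m \<cdot> w1 - s2 m \<cdot> v1) + \<d> (\<rho>2 \<cdot> w - \<sigma> \<cdot> v) - \<d> (tt m \<cdot> u)"
        using dif_diff[OF arr_add[OF arr_diff[OF t'(6,7)] arr_diff[OF t'(4,5)]] t'(8)]
          dif_add_arr[OF arr_diff[OF t'(6,7)] arr_diff[OF t'(4,5)]] by simp
      moreover have "map_j X' \<cdot> ?V = map_j X' \<cdot> (r1 m \<cdot> v1) - map_j X' \<cdot> (\<rho>1 \<cdot> v) - map_j X' \<cdot> (s1 m \<cdot> u)"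
        using cmp_diff[OF c'(2) arr_diff[OF t'(2,1)] t'(3)] cmp_diff[OF c'(2) t'(2,1)] by simp
      moreover have "- \<d> (r2 m \<cdot> w1 - s2 m \<cdot> v1) - map_j X' \<cdot> (r1 m \<cdot> v1) =
          (r2 m \<cdot> ?w - r2 m \<cdot> (map_h X \<cdot> u)) - (s2 m \<cdot> ?v - s2 m \<cdot> (map_f X \<cdot> u))"
        using cone1(2) cmp_diff[OF M(3) t2 tX(2)] cmp_diff[OF M(5) t(1) tX(1)] by (simp flip: e1 e2)
      then have "\<d> (r2 m \<cdot> w1 - s2 m \<cdot> v1) = (s2 m \<cdot> ?v - s2 m \<cdot> (map_f X \<cdot> u)) -
          (r2 m \<cdot> ?w - r2 m \<cdot> (map_h X \<cdot> u)) - map_j X' \<cdot> (r1 m \<cdot> v1)"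
        by (simp add: diff_eq_eq minus_equation_iff[of "\<d> _"])
      moreover have "r2 m \<cdot> ?w = \<d> (\<rho>2 \<cdot> w - \<sigma> \<cdot> v) - map_j X' \<cdot> (\<rho>1 \<cdot> v) + w + s2 m \<cdot> ?v"
        using C2 by (simp add: diff_eq_eq)
      ultimately show ?thesis
        by (simp only: sq(2)) simp
    qed
    moreover have "\<d> (r0 m \<cdot> u) = 0"
      using dif_cmp_closed_right[OF M(1) u] M(7) zero_cmp[OF u(1) arr_obj(2)[OF M(1)]] by simp
    moreover have "arr A Y (ob1 X') (n - 1) ?V" "arr A Y (ob2 X') (n - 2) ?W"
      by (intro arr_diff arr_add t')+
    ultimately show "\<exists>u v' w'. arr A Y (ob0 X') n u \<and> \<d> u = 0 \<and>
        arr A Y (ob1 X') (n - 1) v' \<and> arr A Y (ob2 X') (n - 2) w' \<and>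
        v - map_f X' \<cdot> u = \<d> v' \<and> w - map_h X' \<cdot> u = - \<d> w' - map_j X' \<cdot> v'"
      using t'(9) by blast
  qed
qed

text \<open>An isomorphism exhibits \<open>X'\<close> as a retract of \<open>X\<close> up to
  homotopy, so the retract argument applies to every test object and degree.\<close>

lemma h_left_exact_isomorphic:
  assumes "h_left_exact A X" "h_isomorphic A X X'"
  shows "h_left_exact A X'"
  using assms unfolding h_left_exact_iff h_isomorphic_def by (metis left_exact_at_retract)

end

section \<open>Homotopy equivalences and replacement of the middle object\<close>

definition h_equivalence ::
  "('o, 'm::ab_group_add, 'k) dg_cat \<Rightarrow> 'o \<Rightarrow> 'o \<Rightarrow> 'm \<Rightarrow> 'm \<Rightarrow> bool" where
  "h_equivalence A X Y g g' \<longleftrightarrow>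
    arr A X Y 0 g \<and> dif A g = 0 \<and> arr A Y X 0 g' \<and> dif A g' = 0 \<and>
    (\<exists>\<theta>. arr A X X (-1) \<theta> \<and> g' \<cdot>\<^bsub>A\<^esub> g - idn A X = dif A \<theta>) \<and>
    (\<exists>\<eta>. arr A Y Y (-1) \<eta> \<and> g \<cdot>\<^bsub>A\<^esub> g' - idn A Y = dif A \<eta>)"

context dg_category
begin

lemma dif_cmp_closed0: "arr A Y Z 0 g \<Longrightarrow> \<d> g = 0 \<Longrightarrow> arr A X Y n f \<Longrightarrow> \<d> (g \<cdot> f) = g \<cdot> \<d> f"
  by (simp add: dif_cmp_closed_left)

text \<open>Injectivity on cohomology of composition with \<open>g\<close>. For closed
  \<open>x\<close> the homotopy gives d(\<theta>x) = g'gx - x, hence x = d(g'y - \<theta>x).\<close>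

lemma h_equivalence_exact:
  assumes g: "h_equivalence A D P g g'" and x: "arr A Y D n x" "\<d> x = 0"
    and y: "arr A Y P (n - 1) y" "g \<cdot> x = \<d> y"
  shows "\<exists>z. arr A Y D (n - 1) z \<and> x = \<d> z"
proof -
  obtain \<theta> where \<theta>: "arr A D D (-1) \<theta>" "g' \<cdot> g - idn A D = \<d> \<theta>"
    and a: "arr A D P 0 g" "arr A P D 0 g'" "\<d> g' = 0"
    using g by (auto simp: h_equivalence_def)
  have t: "arr A Y D (n - 1) (g' \<cdot> y)" "arr A Y D (n - 1) (\<theta> \<cdot> x)"
    using arr_cmp[OF a(2) y(1)] arr_cmp[OF \<theta>(1) x(1)] by simp_all
  have "\<d> (\<theta> \<cdot> x) = g' \<cdot> (g \<cdot> x) - x"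
    using dif_cmp_closed_right[OF \<theta>(1) x] diff_cmp[OF arr_cmp[OF a(2,1) refl] _ x(1)] arr_idn[of D] arr_obj[OF a(1)]
      cmp_assoc_arr[OF a(2,1) x(1)] idn_cmp[OF x(1)] by (simp flip: \<theta>(2))
  then have "x = \<d> (g' \<cdot> y - \<theta> \<cdot> x)"
    using dif_diff[OF t] dif_cmp_closed0[OF a(2,3) y(1)] y(2) by simp
  then show ?thesis
    using arr_diff[OF t] by blast
qed

text \<open>Surjectivity on cohomology of composition with \<open>g\<close>: the lift is g'y, and
  d(\<eta>y) = gg'y - y accounts for the difference.\<close>

lemma h_equivalence_lift:
  assumes g: "h_equivalence A D P g g'" and y: "arr A Y P n y" "\<d> y = 0"
  shows "\<exists>x z. arr A Y D n x \<and> \<d> x = 0 \<and> arr A Y P (n - 1) z \<and> y = g \<cdot> x + \<d> z"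
proof -
  obtain \<eta> where \<eta>: "arr A P P (-1) \<eta>" "g \<cdot> g' - idn A P = \<d> \<eta>"
    and a: "arr A D P 0 g" "arr A P D 0 g'" "\<d> g' = 0"
    using g by (auto simp: h_equivalence_def)
  have t: "arr A Y D n (g' \<cdot> y)" "arr A Y P (n - 1) (\<eta> \<cdot> y)"
    using arr_cmp[OF a(2) y(1)] arr_cmp[OF \<eta>(1) y(1)] by simp_all
  have "\<d> (\<eta> \<cdot> y) = g \<cdot> (g' \<cdot> y) - y"
    using dif_cmp_closed_right[OF \<eta>(1) y] diff_cmp[OF arr_cmp[OF a(1,2) refl] _ y(1)] arr_idn[of P] arr_obj[OF a(1)]
      cmp_assoc_arr[OF a(1,2) y(1)] idn_cmp[OF y(1)] by (simp flip: \<eta>(2))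
  then have "y = g \<cdot> (g' \<cdot> y) + \<d> (- (\<eta> \<cdot> y))"
    using dif_minus[OF t(2)] by simp
  moreover have "\<d> (g' \<cdot> y) = 0"
    using dif_cmp_closed0[OF a(2,3) y(1)] y(2) cmp_zero[OF a(2) arr_obj(1)[OF y(1)]] by simp
  ultimately show ?thesis
    using t arr_minus by blast
qed

text \<open>Injectivity on cohomology of precomposition with \<open>g\<close>. Differentiating
  x\<eta> passes the differential over \<open>x\<close>, which has degree \<open>n\<close>;
  \<open>koszul n\<close> cancels the resulting sign.\<close>

lemma h_equivalence_coexact:
  assumes g: "h_equivalence A P D g g'" and x: "arr A D Y n x" "\<d> x = 0"
    and y: "arr A P Y (n - 1) y" "x \<cdot> g = \<d> y"
  shows "\<exists>z. arr A D Y (n - 1) z \<and> x = \<d> z"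
proof -
  obtain \<eta> where \<eta>: "arr A D D (-1) \<eta>" "g \<cdot> g' - idn A D = \<d> \<eta>"
    and a: "arr A P D 0 g" "arr A D P 0 g'" "\<d> g' = 0"
    using g by (auto simp: h_equivalence_def)
  have t: "arr A D Y (n - 1) (y \<cdot> g')" "arr A D Y (n - 1) (koszul n (x \<cdot> \<eta>))"
    using arr_cmp[OF y(1) a(2)] arr_koszul[OF arr_cmp[OF x(1) \<eta>(1)]] by simp_all
  have "\<d> (koszul n (x \<cdot> \<eta>)) = (x \<cdot> g) \<cdot> g' - x"
    using dif_cmp_closed_left[OF x(1) \<eta>(1) x(2)] dif_koszul[OF arr_cmp[OF x(1) \<eta>(1) refl]]
      cmp_diff[OF x(1) arr_cmp[OF a(1,2) refl]] arr_idn[of D] arr_obj[OF a(1)]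
      cmp_assoc_arr[OF x(1) a(1,2)] cmp_idn[OF x(1)] by (simp flip: \<eta>(2))
  then have "x = \<d> (y \<cdot> g' - koszul n (x \<cdot> \<eta>))"
    using dif_diff[OF t] dif_cmp_closed_right[OF y(1) a(2,3)] y(2) by simp
  then show ?thesis
    using arr_diff[OF t] by blast
qed

text \<open>Surjectivity on cohomology of precomposition with \<open>g\<close>: the extension is
  yg', and \<open>koszul n\<close> again absorbs the sign in differentiating y\<theta>.\<close>

lemma h_equivalence_extend:
  assumes g: "h_equivalence A P D g g'" and y: "arr A P Y n y" "\<d> y = 0"
  shows "\<exists>x z. arr A D Y n x \<and> \<d> x = 0 \<and> arr A P Y (n - 1) z \<and> y = x \<cdot> g + \<d> z"
proof -
  obtain \<theta> where \<theta>: "arr A P P (-1) \<theta>" "g' \<cdot> g - idn A P = \<d> \<theta>"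
    and a: "arr A P D 0 g" "arr A D P 0 g'" "\<d> g' = 0"
    using g by (auto simp: h_equivalence_def)
  have t: "arr A D Y n (y \<cdot> g')" "arr A P Y (n - 1) (koszul n (y \<cdot> \<theta>))"
    using arr_cmp[OF y(1) a(2)] arr_koszul[OF arr_cmp[OF y(1) \<theta>(1)]] by simp_all
  have "\<d> (koszul n (y \<cdot> \<theta>)) = (y \<cdot> g') \<cdot> g - y"
    using dif_cmp_closed_left[OF y(1) \<theta>(1) y(2)] dif_koszul[OF arr_cmp[OF y(1) \<theta>(1) refl]]
      cmp_diff[OF y(1) arr_cmp[OF a(2,1) refl]] arr_idn[of P] arr_obj[OF a(1)]
      cmp_assoc_arr[OF y(1) a(2,1)] cmp_idn[OF y(1)] by (simp flip: \<theta>(2))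
  then have "y = (y \<cdot> g') \<cdot> g + \<d> (- koszul n (y \<cdot> \<theta>))"
    using dif_minus[OF t(2)] by simp
  moreover have "\<d> (y \<cdot> g') = 0"
    using dif_cmp_closed_right[OF y(1) a(2,3)] y(2) zero_cmp[OF a(2) arr_obj(2)[OF y(1)]] by simp
  ultimately show ?thesis
    using t arr_minus by blast
qed

text \<open>Because j = j'g holds strictly, (v, w) \<mapsto> (gv, w) is a chain map from the cone of
  j to that of j', and it is bijective on cohomology as \<open>g\<close> is an equivalence. For the
  same reason \<open>map_h X\<close> can be kept: d(h) = -jf = -j'(gf).\<close>

lemma h_left_exact_middle:
  assumes X: "h_left_exact A X" and g: "h_equivalence A (ob1 X) P g g'"
    and j: "arr A P (ob2 X) 0 j'" "\<d> j' = 0" "map_j X = j' \<cdot> g"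
  shows "h_left_exact A (X\<lparr>ob1 := P, map_f := g \<cdot> map_f X, map_j := j'\<rparr>)" (is "h_left_exact A ?X'")
proof -
  let ?f = "map_f X" and ?j = "map_j X" and ?h = "map_h X"
  have cX: "h_complex A X" using X by (simp add: h_left_exact_iff)
  note c = h_complex_arr[OF cX]
  have g1: "arr A (ob1 X) P 0 g" "\<d> g = 0" using g by (simp_all add: h_equivalence_def)
  note gf = arr_cmp[OF g1(1) c(1) refl, simplified]
  have "\<d> (g \<cdot> ?f) = 0"
    using dif_cmp_closed0[OF g1 c(1)] c(4) cmp_zero[OF g1(1) arr_obj(1)[OF c(1)]] by simp
  then have cX': "h_complex A ?X'"
    using cX c(6) gf g1 j cmp_assoc_arr[OF j(1) g1(1) c(1)]
    by (simp add: h_complex_def arr_def Z0_def)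
  have "left_exact_at A ?X' Y n" if Y: "Y \<in> Obj A" "n \<le> 0" for Y n
  proof -
    have exact: "left_exact_at A X Y n" using X Y by (simp add: h_left_exact_iff)
    have jg: "j' \<cdot> (g \<cdot> v + \<d> z) = ?j \<cdot> v + \<d> (j' \<cdot> z)"
      if "arr A Y (ob1 X) i v" "arr A Y P (i - 1) z" for v z i
      using cmp_add[OF j(1) arr_cmp[OF g1(1) that(1) refl], of "\<d> z"] arr_dif[OF that(2)]
        dif_cmp_closed0[OF j(1,2) that(2)] cmp_assoc_arr[OF j(1) g1(1) that(1)] j(3) by simp
    show ?thesis
      unfolding left_exact_at_def
    proof (intro conjI allI impI; simp)
      fix u v w
      assume H: "arr A Y (ob0 X) n u \<and> \<d> u = 0 \<and> arr A Y P (n - 1) v \<and>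
        arr A Y (ob2 X) (n - 2) w \<and> (g \<cdot> ?f) \<cdot> u = \<d> v \<and> ?h \<cdot> u = - \<d> w - j' \<cdot> v"
      then have u: "arr A Y (ob0 X) n u" "\<d> u = 0" and v: "arr A Y P (n - 1) v"
        and w: "arr A Y (ob2 X) (n - 2) w" by simp_all
      have fu: "arr A Y (ob1 X) n (?f \<cdot> u)" using arr_cmp[OF c(1) u(1)] by simp
      have dfu: "\<d> (?f \<cdot> u) = 0"
        using dif_cmp_closed0[OF c(1,4) u(1)] u(2) cmp_zero[OF c(1) Y(1)] by simp
      have gfu: "g \<cdot> (?f \<cdot> u) = \<d> v" using H cmp_assoc_arr[OF g1(1) c(1) u(1)] by simp
      obtain v0 where v0: "arr A Y (ob1 X) (n - 1) v0" "?f \<cdot> u = \<d> v0"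
        using h_equivalence_exact[OF g fu dfu v gfu] by blast
      have gv0: "arr A Y P (n - 1) (g \<cdot> v0)" using arr_cmp[OF g1(1) v0(1)] by simp
      \<comment> \<open>\<open>v0\<close> was found from \<open>?f \<cdot> u\<close> alone and may
        not fit \<open>w\<close>. Its defect is a cocycle, hence of the form
        \<open>g \<cdot> x + \<d> z\<close>; then \<open>x\<close> corrects \<open>v0\<close>, and
        \<open>j' \<cdot> z\<close> corrects \<open>w\<close>.\<close>
      have "\<d> (v - g \<cdot> v0) = 0"
        using dif_diff[OF v gv0] dif_cmp_closed0[OF g1 v0(1)] gfu v0(2) by simp
      then obtain x z where x: "arr A Y (ob1 X) (n - 1) x" "\<d> x = 0"
        and z: "arr A Y P (n - 1 - 1) z" "v - g \<cdot> v0 = g \<cdot> x + \<d> z"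
        using h_equivalence_lift[OF g arr_diff[OF v gv0]] by blast
      have jz: "arr A Y (ob2 X) (n - 2) (j' \<cdot> z)" using arr_cmp[OF j(1) z(1)] by simp
      have "v = g \<cdot> (v0 + x) + \<d> z" using z(2) cmp_add[OF g1(1) v0(1) x(1)] by (simp add: diff_eq_eq ac_simps)
      then have "?h \<cdot> u = - \<d> (w + j' \<cdot> z) - ?j \<cdot> (v0 + x)"
        using H jg[OF arr_add[OF v0(1) x(1)] z(1)] dif_add_arr[OF w jz] by (simp add: algebra_simps)
      moreover have "?f \<cdot> u = \<d> (v0 + x)" using v0 x dif_add_arr[OF v0(1) x(1)] by simp
      ultimately show "\<exists>u'. arr A Y (ob0 X) (n - 1) u' \<and> u = \<d> u'"
        using exact u arr_add[OF v0(1) x(1)] arr_add[OF w jz] unfolding left_exact_at_def by blast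
    next
      fix v w
      assume H: "arr A Y P n v \<and> \<d> v = 0 \<and> arr A Y (ob2 X) (n - 1) w \<and> \<d> w = - (j' \<cdot> v)"
      then have w: "arr A Y (ob2 X) (n - 1) w" by simp
      \<comment> \<open>Replacing \<open>v\<close> by \<open>g \<cdot> x\<close> drops the boundary
        \<open>\<d> z\<close>; adding \<open>j' \<cdot> z\<close> to \<open>w\<close> compensates
        for it and gives a cocycle in the cone of \<open>?j\<close>.\<close>
      obtain x z where x: "arr A Y (ob1 X) n x" "\<d> x = 0" and z: "arr A Y P (n - 1) z" "v = g \<cdot> x + \<d> z"
        using h_equivalence_lift[OF g] H by blast
      have jz: "arr A Y (ob2 X) (n - 1) (j' \<cdot> z)" using arr_cmp[OF j(1) z(1)] by simp
      have "\<d> (w + j' \<cdot> z) = - (?j \<cdot> x)"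
        using H z(2) jg[OF x(1) z(1)] dif_add_arr[OF w jz] by simp
      then obtain u v1 w1 where u: "arr A Y (ob0 X) n u" "\<d> u = 0" and v1: "arr A Y (ob1 X) (n - 1) v1"
        and w1: "arr A Y (ob2 X) (n - 2) w1" and e: "x - ?f \<cdot> u = \<d> v1"
          "w + j' \<cdot> z - ?h \<cdot> u = - \<d> w1 - ?j \<cdot> v1"
        using exact x arr_add[OF w jz] unfolding left_exact_at_def by blast
      have gv: "arr A Y P (n - 1) (g \<cdot> v1)" using arr_cmp[OF g1(1) v1] by simp
      have "g \<cdot> x - g \<cdot> (?f \<cdot> u) = \<d> (g \<cdot> v1)"
        using cmp_diff[OF g1(1) x(1) arr_cmp[OF c(1) u(1)]] e(1) dif_cmp_closed0[OF g1 v1] by simp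
      then have "v - (g \<cdot> ?f) \<cdot> u = \<d> (g \<cdot> v1 + z)"
        using z(2) dif_add_arr[OF gv z(1)] cmp_assoc_arr[OF g1(1) c(1) u(1)] by (simp add: algebra_simps)
      moreover have "w - ?h \<cdot> u = - \<d> w1 - j' \<cdot> (g \<cdot> v1 + z)"
        using e(2) cmp_add[OF j(1) gv z(1)] cmp_assoc_arr[OF j(1) g1(1) v1] j(3) by (simp add: algebra_simps)
      ultimately show "\<exists>u. arr A Y (ob0 X) n u \<and> \<d> u = 0 \<and>
          (\<exists>v'. arr A Y P (n - 1) v' \<and> (\<exists>w'. arr A Y (ob2 X) (n - 2) w' \<and>
            v - (g \<cdot> ?f) \<cdot> u = \<d> v' \<and> w - ?h \<cdot> u = - \<d> w' - j' \<cdot> v'))"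
        using u arr_add[OF gv z(1)] w1 by blast
    qed
  qed
  then show ?thesis
    using cX' by (simp add: h_left_exact_iff)
qed

text \<open>Dual to the left exact case, with \<open>g\<close> now leading from the new middle
  object to the old one. Strictness of f = gf' makes (v, w) \<mapsto> (vg, w) a chain map, and
  \<open>map_h X\<close> again stays the same.\<close>

lemma h_right_exact_middle:
  assumes X: "h_right_exact A X" and g: "h_equivalence A P (ob1 X) g g'"
    and f: "arr A (ob0 X) P 0 f'" "\<d> f' = 0" "map_f X = g \<cdot> f'"
  shows "h_right_exact A (X\<lparr>ob1 := P, map_f := f', map_j := map_j X \<cdot> g\<rparr>)" (is "h_right_exact A ?X'")
proof -
  let ?f = "map_f X" and ?j = "map_j X" and ?h = "map_h X"
  have cX: "h_complex A X" using X by (simp add: h_right_exact_iff)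
  note c = h_complex_arr[OF cX]
  have g1: "arr A P (ob1 X) 0 g" "\<d> g = 0" using g by (simp_all add: h_equivalence_def)
  note jg = arr_cmp[OF c(2) g1(1) refl, simplified]
  have "\<d> (?j \<cdot> g) = 0"
    using dif_cmp_closed0[OF c(2,5) g1(1)] g1(2) cmp_zero[OF c(2) arr_obj(1)[OF g1(1)]] by simp
  then have cX': "h_complex A ?X'"
    using cX c(6) jg g1 f cmp_assoc_arr[OF c(2) g1(1) f(1)]
    by (simp add: h_complex_def arr_def Z0_def)
  have "right_exact_at A ?X' Y n" if Y: "Y \<in> Obj A" "n \<le> 0" for Y n
  proof -
    have exact: "right_exact_at A X Y n" using X Y by (simp add: h_right_exact_iff)
    have gf: "(v \<cdot> g + \<d> z) \<cdot> f' = v \<cdot> ?f + \<d> (z \<cdot> f')"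
      if "arr A (ob1 X) Y i v" "arr A P Y (i - 1) z" for v z i
      using add_cmp[OF arr_cmp[OF that(1) g1(1) refl] _ f(1), of "\<d> z"] arr_dif[OF that(2)]
        dif_cmp_closed_right[OF that(2) f(1,2)] cmp_assoc_arr[OF that(1) g1(1) f(1)] f(3) by simp
    show ?thesis
      unfolding right_exact_at_def
    proof (intro conjI allI impI; simp)
      fix u v w
      assume H: "arr A (ob2 X) Y n u \<and> \<d> u = 0 \<and> arr A P Y (n - 1) v \<and>
        arr A (ob0 X) Y (n - 2) w \<and> u \<cdot> (?j \<cdot> g) = \<d> v \<and> koszul n (u \<cdot> ?h) = - \<d> w - v \<cdot> f'"
      then have u: "arr A (ob2 X) Y n u" "\<d> u = 0" and v: "arr A P Y (n - 1) v"
        and w: "arr A (ob0 X) Y (n - 2) w" by simp_all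
      have uj: "arr A (ob1 X) Y n (u \<cdot> ?j)" using arr_cmp[OF u(1) c(2)] by simp
      have duj: "\<d> (u \<cdot> ?j) = 0"
        using dif_cmp_closed_right[OF u(1) c(2,5)] u(2) zero_cmp[OF c(2) Y(1)] by simp
      have ujg: "(u \<cdot> ?j) \<cdot> g = \<d> v" using H cmp_assoc_arr[OF u(1) c(2) g1(1)] by simp
      obtain v0 where v0: "arr A (ob1 X) Y (n - 1) v0" "u \<cdot> ?j = \<d> v0"
        using h_equivalence_coexact[OF g uj duj v ujg] by blast
      have gv0: "arr A P Y (n - 1) (v0 \<cdot> g)" using arr_cmp[OF v0(1) g1(1)] by simp
      have "\<d> (v - v0 \<cdot> g) = 0"
        using dif_diff[OF v gv0] dif_cmp_closed_right[OF v0(1) g1] ujg v0(2) by simp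
      then obtain x z where x: "arr A (ob1 X) Y (n - 1) x" "\<d> x = 0"
        and z: "arr A P Y (n - 1 - 1) z" "v - v0 \<cdot> g = x \<cdot> g + \<d> z"
        using h_equivalence_extend[OF g arr_diff[OF v gv0]] by blast
      have zf: "arr A (ob0 X) Y (n - 2) (z \<cdot> f')" using arr_cmp[OF z(1) f(1)] by simp
      have "v = (v0 + x) \<cdot> g + \<d> z" using z(2) add_cmp[OF v0(1) x(1) g1(1)] by (simp add: diff_eq_eq ac_simps)
      then have "koszul n (u \<cdot> ?h) = - \<d> (w + z \<cdot> f') - (v0 + x) \<cdot> ?f"
        using H gf[OF arr_add[OF v0(1) x(1)] z(1)] dif_add_arr[OF w zf] by (simp add: algebra_simps)
      moreover have "u \<cdot> ?j = \<d> (v0 + x)" using v0 x dif_add_arr[OF v0(1) x(1)] by simp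
      ultimately show "\<exists>u'. arr A (ob2 X) Y (n - 1) u' \<and> u = \<d> u'"
        using exact u arr_add[OF v0(1) x(1)] arr_add[OF w zf] unfolding right_exact_at_def by blast
    next
      fix v w
      assume H: "arr A P Y n v \<and> \<d> v = 0 \<and> arr A (ob0 X) Y (n - 1) w \<and> \<d> w = - (v \<cdot> f')"
      then have w: "arr A (ob0 X) Y (n - 1) w" by simp
      obtain x z where x: "arr A (ob1 X) Y n x" "\<d> x = 0" and z: "arr A P Y (n - 1) z" "v = x \<cdot> g + \<d> z"
        using h_equivalence_extend[OF g] H by blast
      have zf: "arr A (ob0 X) Y (n - 1) (z \<cdot> f')" using arr_cmp[OF z(1) f(1)] by simp
      have "\<d> (w + z \<cdot> f') = - (x \<cdot> ?f)"
        using H z(2) gf[OF x(1) z(1)] dif_add_arr[OF w zf] by simp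
      then obtain u v1 w1 where u: "arr A (ob2 X) Y n u" "\<d> u = 0" and v1: "arr A (ob1 X) Y (n - 1) v1"
        and w1: "arr A (ob0 X) Y (n - 2) w1" and e: "x - u \<cdot> ?j = \<d> v1"
          "w + z \<cdot> f' - koszul n (u \<cdot> ?h) = - \<d> w1 - v1 \<cdot> ?f"
        using exact x arr_add[OF w zf] unfolding right_exact_at_def by blast
      have gv: "arr A P Y (n - 1) (v1 \<cdot> g)" using arr_cmp[OF v1 g1(1)] by simp
      have "x \<cdot> g - (u \<cdot> ?j) \<cdot> g = \<d> (v1 \<cdot> g)"
        using diff_cmp[OF x(1) arr_cmp[OF u(1) c(2)] g1(1)] e(1) dif_cmp_closed_right[OF v1 g1] by simp
      then have "v - u \<cdot> (?j \<cdot> g) = \<d> (v1 \<cdot> g + z)"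
        using z(2) dif_add_arr[OF gv z(1)] cmp_assoc_arr[OF u(1) c(2) g1(1)] by (simp add: algebra_simps)
      moreover have "w - koszul n (u \<cdot> ?h) = - \<d> w1 - (v1 \<cdot> g + z) \<cdot> f'"
        using e(2) add_cmp[OF gv z(1) f(1)] cmp_assoc_arr[OF v1 g1(1) f(1)] f(3) by (simp add: algebra_simps)
      ultimately show "\<exists>u. arr A (ob2 X) Y n u \<and> \<d> u = 0 \<and>
          (\<exists>v'. arr A P Y (n - 1) v' \<and> (\<exists>w'. arr A (ob0 X) Y (n - 2) w' \<and>
            v - u \<cdot> (?j \<cdot> g) = \<d> v' \<and> w - koszul n (u \<cdot> ?h) = - \<d> w' - v' \<cdot> f'))"
        using u arr_add[OF gv z(1)] w1 by blast
    qed
  qed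
  then show ?thesis
    using cX' by (simp add: h_right_exact_iff)
qed

end

section \<open>The closure under finite direct sums\<close>

lemma sum_closure_simps [simp]:
  "Obj (sum_closure A) = lists (Obj A)"
  "smul (sum_closure A) = (\<lambda>c M i j. smul A c (M i j))"
  "dif (sum_closure A) = (\<lambda>M i j. dif A (M i j))"
  "idn (sum_closure A) = (\<lambda>xs i j. if i = j \<and> i < length xs then idn A (xs ! i) else 0)"
  by (simp_all add: sum_closure_def)

context dg_category
begin

lemma arr_sum: "X \<in> Obj A \<Longrightarrow> Y \<in> Obj A \<Longrightarrow> (\<And>k. k \<in> K \<Longrightarrow> arr A X Y n (f k)) \<Longrightarrow> arr A X Y n (sum f K)"
  by (induction K rule: infinite_finite_induct) (simp_all add: arr_zero arr_add)

lemma sum_cmp: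
  assumes "X \<in> Obj A" "Y \<in> Obj A" "Z \<in> Obj A" "arr A X Y m f" "\<And>k. k \<in> K \<Longrightarrow> arr A Y Z n (g k)"
  shows "sum g K \<cdot> f = (\<Sum>k\<in>K. g k \<cdot> f)"
  using assms(5)
proof (induction K rule: infinite_finite_induct)
  case (insert k K)
  then show ?case
    using add_cmp[OF _ arr_sum[of Y Z K n g] assms(4), of "g k"] assms by simp
qed (simp_all add: zero_cmp[OF assms(4,3)])

lemma cmp_sum:
  assumes "X \<in> Obj A" "Y \<in> Obj A" "Z \<in> Obj A" "arr A Y Z n g" "\<And>k. k \<in> K \<Longrightarrow> arr A X Y m (f k)"
  shows "g \<cdot> sum f K = (\<Sum>k\<in>K. g \<cdot> f k)"
  using assms(5)
proof (induction K rule: infinite_finite_induct)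
  case (insert k K)
  then show ?case
    using cmp_add[OF assms(4) _ arr_sum[of X Y K m f], of "f k"] assms by simp
qed (simp_all add: cmp_zero[OF assms(4,1)])

lemma dif_sum:
  assumes "X \<in> Obj A" "Y \<in> Obj A" "\<And>k. k \<in> K \<Longrightarrow> arr A X Y m (f k)"
  shows "\<d> (sum f K) = (\<Sum>k\<in>K. \<d> (f k))"
  using assms(3)
proof (induction K rule: infinite_finite_induct)
  case (insert k K)
  then show ?case
    using dif_add_arr[OF _ arr_sum[of X Y K m f], of "f k"] assms by simp
qed (simp_all add: dif_zero[OF assms(1,2)])

lemma koszul_sum: "koszul n (sum f K) = (\<Sum>k\<in>K. koszul n (f k :: 'm))"
  by (simp add: koszul_def sum_negf)

lemma koszul_fun: "koszul n M i j = koszul n (M i j :: 'm)"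
  by (simp add: koszul_def)

lemma arr_sum_closure:
  "arr (sum_closure A) xs ys n M \<longleftrightarrow> xs \<in> lists (Obj A) \<and> ys \<in> lists (Obj A) \<and>
    (\<forall>i j. if i < length ys \<and> j < length xs then arr A (xs ! j) (ys ! i) n (M i j) else M i j = 0)"
  by (auto simp: arr_def sum_closure_def in_lists_conv_set)

text \<open>The defining sum runs over the nonzero entries of a column of \<open>N\<close>. Products
  with zero vanish only between typed morphisms, so the typing of both matrices is what allows the
  sum to range over all indices of the middle list.\<close>

lemma sum_closure_cmp:
  assumes M: "arr (sum_closure A) ys zs n M" and N: "arr (sum_closure A) xs ys m N"
  shows "M \<cdot>\<^bsub>sum_closure A\<^esub> N =
    (\<lambda>i j. if i < length zs \<and> j < length xs then \<Sum>k<length ys. M i k \<cdot> N k j else 0)"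
proof (intro ext)
  fix i j
  have Nz: "N k j = 0" if "\<not> (k < length ys \<and> j < length xs)" for k
    using N that by (simp add: arr_sum_closure)
  have "M \<cdot>\<^bsub>sum_closure A\<^esub> N = (\<lambda>i j. \<Sum>k | N k j \<noteq> 0. M i k \<cdot> N k j)"
    by (simp add: sum_closure_def)
  moreover have "(\<Sum>k | N k j \<noteq> 0. M i k \<cdot> N k j) =
      (if i < length zs \<and> j < length xs then \<Sum>k<length ys. M i k \<cdot> N k j else 0)"
  proof (cases "i < length zs \<and> j < length xs")
    case True
    have "M i k \<cdot> N k j = 0" if "k < length ys" "N k j = 0" for k
    proof -
      have "arr A (ys ! k) (zs ! i) n (M i k)" "xs ! j \<in> Obj A"
        using M N True that(1) by (auto simp: arr_sum_closure in_lists_conv_set)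
      then show ?thesis using that(2) by (simp add: cmp_zero)
    qed
    moreover have "{k. N k j \<noteq> 0} \<subseteq> {..<length ys}"
      using Nz by auto
    ultimately have "(\<Sum>k | N k j \<noteq> 0. M i k \<cdot> N k j) = (\<Sum>k<length ys. M i k \<cdot> N k j)"
      by (intro sum.mono_neutral_left) auto
    with True show ?thesis by simp
  next
    \<comment> \<open>If \<open>j\<close> is out of range, the column of \<open>N\<close> is zero
      and the sum is empty. If \<open>i\<close> is out of range, each term is
      \<open>0 \<cdot> N k j\<close> with \<open>N k j\<close> typed.\<close>
    case False
    have "M i k \<cdot> N k j = 0" if "N k j \<noteq> 0" for k
    proof -
      have k: "k < length ys" "j < length xs" using Nz that by blast+
      then have "arr A (xs ! j) (ys ! k) m (N k j)" using N by (simp add: arr_sum_closure)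
      moreover have "M i k = 0" using M k False by (simp add: arr_sum_closure)
      ultimately show ?thesis using zero_cmp arr_obj by metis
    qed
    then show ?thesis using False by (auto intro: sum.neutral)
  qed
  ultimately show "(M \<cdot>\<^bsub>sum_closure A\<^esub> N) i j =
      (if i < length zs \<and> j < length xs then \<Sum>k<length ys. M i k \<cdot> N k j else 0)"
    by simp
qed

lemma sum_closure_arr_cmp:
  assumes M: "arr (sum_closure A) ys zs n M" and N: "arr (sum_closure A) xs ys m N"
  shows "arr (sum_closure A) xs zs (n + m) (M \<cdot>\<^bsub>sum_closure A\<^esub> N)"
proof -
  have "arr A (xs ! j) (zs ! i) (n + m) (\<Sum>k<length ys. M i k \<cdot> N k j)"
    if "i < length zs" "j < length xs" for i j
  proof (rule arr_sum)
    show "xs ! j \<in> Obj A" "zs ! i \<in> Obj A"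
      using M N that by (auto simp: arr_sum_closure in_lists_conv_set)
    show "arr A (xs ! j) (zs ! i) (n + m) (M i k \<cdot> N k j)" if k: "k \<in> {..<length ys}" for k
      using M N \<open>i < length zs\<close> \<open>j < length xs\<close> k
      by (intro arr_cmp[where Y = "ys ! k" and n = n and m = m]) (simp_all add: arr_sum_closure)
  qed
  then show ?thesis
    unfolding sum_closure_cmp[OF M N] using M N by (simp add: arr_sum_closure)
qed

text \<open>If \<open>Obj A\<close> is empty, \<open>dif A 0\<close> is arbitrary, but the zero matrix has to be closed.\<close>

lemma dg_category_sum_closure:
  assumes "Obj A \<noteq> {}"
  shows "dg_category (sum_closure A)"
proof -
  let ?S = "sum_closure A"
  have entry: "arr A (xs ! j) (ys ! i) n (M i j)"
    if "arr ?S xs ys n M" "i < length ys" "j < length xs" for xs ys n M i j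
    using that by (simp add: arr_sum_closure)
  have outside: "M i j = 0" if "arr ?S xs ys n M" "\<not> (i < length ys \<and> j < length xs)" for xs ys n M i j
    using that by (auto simp: arr_sum_closure)
  have nth: "xs ! i \<in> Obj A" if "xs \<in> Obj ?S" "i < length xs" for xs i
    using that by (simp add: in_lists_conv_set)
  have zero: "\<d> 0 = 0"
    using dif_zero assms by blast
  have dif: "arr ?S xs ys (n + 1) (\<lambda>i j. \<d> (M i j))" if M: "arr ?S xs ys n M" for xs ys n M
    using M arr_dif[OF entry[OF M] refl] zero unfolding arr_sum_closure by simp
  interpret module "smul A" by (rule smul_module)
  have mod: "module (smul ?S)"
    by unfold_locales (simp_all add: fun_eq_iff scale_right_distrib scale_left_distrib)
  have sub: "module.subspace (smul ?S) (Hom ?S X Y n)" if "X \<in> Obj ?S" "Y \<in> Obj ?S" for X Y n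
  proof -
    have hom: "Hom ?S X Y n = {M. arr ?S X Y n M}"
      using that by (simp add: arr_def)
    have "arr A x y n (smul A c f)" if "arr A x y n f" for x y c f
      using that subspace_scale[OF Hom_subspace] by (simp add: arr_def)
    then show ?thesis
      using that nth unfolding module.subspace_def[OF mod] hom
      by (auto simp: arr_sum_closure arr_zero arr_add)
  qed
  show ?thesis
  proof (rule dg_category.intro)
    show "module (smul ?S)" by (fact mod)
    show "module.subspace (smul ?S) (Hom ?S X Y n)" if "X \<in> Obj ?S" "Y \<in> Obj ?S" for X Y n
      using that by (rule sub)
  next
    fix X Y Z f g m n
    assume ob: "X \<in> Obj ?S" "Y \<in> Obj ?S" "Z \<in> Obj ?S" and fg: "f \<in> Hom ?S X Y m" "g \<in> Hom ?S Y Z n"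
    have f: "arr ?S X Y m f" and g: "arr ?S Y Z n g" using ob fg by (simp_all add: arr_def)
    show "g \<cdot>\<^bsub>?S\<^esub> f \<in> Hom ?S X Z (n + m)"
      using sum_closure_arr_cmp[OF g f] by (simp add: arr_def)
    fix f' g' c
    { assume "g' \<in> Hom ?S Y Z n"
      then have g': "arr ?S Y Z n g'" using ob by (simp add: arr_def)
      then have gg': "arr ?S Y Z n (g + g')" using g by (auto simp: arr_sum_closure arr_add)
      show "(g + g') \<cdot>\<^bsub>?S\<^esub> f = g \<cdot>\<^bsub>?S\<^esub> f + g' \<cdot>\<^bsub>?S\<^esub> f"
        unfolding sum_closure_cmp[OF gg' f] sum_closure_cmp[OF g f] sum_closure_cmp[OF g' f]
        by (auto simp: fun_eq_iff simp flip: sum.distrib intro!: sum.cong add_cmp[OF entry[OF g] entry[OF g'] entry[OF f]]) }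
    { assume "f' \<in> Hom ?S X Y m"
      then have f': "arr ?S X Y m f'" using ob by (simp add: arr_def)
      then have ff': "arr ?S X Y m (f + f')" using f by (auto simp: arr_sum_closure arr_add)
      show "g \<cdot>\<^bsub>?S\<^esub> (f + f') = g \<cdot>\<^bsub>?S\<^esub> f + g \<cdot>\<^bsub>?S\<^esub> f'"
        unfolding sum_closure_cmp[OF g ff'] sum_closure_cmp[OF g f] sum_closure_cmp[OF g f']
        by (auto simp: fun_eq_iff simp flip: sum.distrib intro!: sum.cong cmp_add[OF entry[OF g] entry[OF f] entry[OF f']]) }
    have cg: "arr ?S Y Z n (smul ?S c g)" "arr ?S X Y m (smul ?S c f)"
      using module.subspace_scale[OF mod sub] fg ob by (simp_all only: arr_def)
    have scale: "smul A c y \<cdot> x = smul A c (y \<cdot> x)" "y \<cdot> smul A c x = smul A c (y \<cdot> x)"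
      if "arr A V W i x" "arr A W U j y" for V W U i j x y
      using that cmp_smul_left cmp_smul_right unfolding arr_def by metis+
    show "smul ?S c g \<cdot>\<^bsub>?S\<^esub> f = smul ?S c (g \<cdot>\<^bsub>?S\<^esub> f)"
      unfolding sum_closure_cmp[OF cg(1) f] sum_closure_cmp[OF g f]
      by (auto simp: fun_eq_iff scale_sum_right intro!: sum.cong scale[OF entry[OF f] entry[OF g]])
    show "g \<cdot>\<^bsub>?S\<^esub> smul ?S c f = smul ?S c (g \<cdot>\<^bsub>?S\<^esub> f)"
      unfolding sum_closure_cmp[OF g cg(2)] sum_closure_cmp[OF g f]
      by (auto simp: fun_eq_iff scale_sum_right intro!: sum.cong scale[OF entry[OF f] entry[OF g]])
    have df: "arr ?S X Y (m + 1) (dif ?S f)" and dg: "arr ?S Y Z (n + 1) (dif ?S g)"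
      using dif[OF f] dif[OF g] by simp_all
    show "dif ?S (g \<cdot>\<^bsub>?S\<^esub> f) = dif ?S g \<cdot>\<^bsub>?S\<^esub> f + koszul n (g \<cdot>\<^bsub>?S\<^esub> dif ?S f)"
    proof (intro ext)
      fix i j
      have "\<d> (\<Sum>k<length Y. g i k \<cdot> f k j) =
          (\<Sum>k<length Y. \<d> (g i k) \<cdot> f k j) + koszul n (\<Sum>k<length Y. g i k \<cdot> \<d> (f k j))"
        if i: "i < length Z" and j: "j < length X"
      proof -
        have "\<d> (\<Sum>k<length Y. g i k \<cdot> f k j) = (\<Sum>k<length Y. \<d> (g i k \<cdot> f k j))"
          by (rule dif_sum[OF nth[OF ob(1) j] nth[OF ob(3) i]])
            (rule arr_cmp[OF entry[OF g i] entry[OF f _ j] refl]; simp)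
        also have "\<dots> = (\<Sum>k<length Y. \<d> (g i k) \<cdot> f k j + koszul n (g i k \<cdot> \<d> (f k j)))"
          by (rule sum.cong[OF refl]) (rule dif_cmp[OF entry[OF g i] entry[OF f _ j]]; simp)
        finally show ?thesis by (simp add: sum.distrib koszul_sum)
      qed
      then show "dif ?S (g \<cdot>\<^bsub>?S\<^esub> f) i j = (dif ?S g \<cdot>\<^bsub>?S\<^esub> f + koszul n (g \<cdot>\<^bsub>?S\<^esub> dif ?S f)) i j"
        unfolding sum_closure_cmp[OF g f] sum_closure_cmp[OF dg f] sum_closure_cmp[OF g df]
        by (simp add: koszul_fun zero)
    qed
  next
    fix W X Y Z f g h l m n
    assume ob: "W \<in> Obj ?S" "X \<in> Obj ?S" "Y \<in> Obj ?S" "Z \<in> Obj ?S"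
      and fgh: "f \<in> Hom ?S W X l" "g \<in> Hom ?S X Y m" "h \<in> Hom ?S Y Z n"
    have f: "arr ?S W X l f" and g: "arr ?S X Y m g" and h: "arr ?S Y Z n h"
      using ob fgh by (simp_all add: arr_def)
    show "(h \<cdot>\<^bsub>?S\<^esub> g) \<cdot>\<^bsub>?S\<^esub> f = h \<cdot>\<^bsub>?S\<^esub> (g \<cdot>\<^bsub>?S\<^esub> f)"
    proof (intro ext)
      fix i j
      have "(\<Sum>k<length X. (\<Sum>r<length Y. h i r \<cdot> g r k) \<cdot> f k j) =
          (\<Sum>r<length Y. h i r \<cdot> (\<Sum>k<length X. g r k \<cdot> f k j))"
        if i: "i < length Z" and j: "j < length W"
      proof -
        have "(\<Sum>k<length X. (\<Sum>r<length Y. h i r \<cdot> g r k) \<cdot> f k j) =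
            (\<Sum>k<length X. \<Sum>r<length Y. (h i r \<cdot> g r k) \<cdot> f k j)"
          by (intro sum.cong[OF refl]) (rule sum_cmp[OF nth[OF ob(1) j] nth[OF ob(2)] nth[OF ob(4) i] entry[OF f _ j]
              arr_cmp[OF entry[OF h i] entry[OF g] refl]]; simp)
        also have "\<dots> = (\<Sum>k<length X. \<Sum>r<length Y. h i r \<cdot> (g r k \<cdot> f k j))"
          by (intro sum.cong[OF refl]) (rule cmp_assoc_arr[OF entry[OF h i] entry[OF g] entry[OF f _ j]]; simp)
        also have "\<dots> = (\<Sum>r<length Y. \<Sum>k<length X. h i r \<cdot> (g r k \<cdot> f k j))"
          by (rule sum.swap)
        also have "\<dots> = (\<Sum>r<length Y. h i r \<cdot> (\<Sum>k<length X. g r k \<cdot> f k j))"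
          by (intro sum.cong[OF refl]) (rule cmp_sum[symmetric, OF nth[OF ob(1) j] nth[OF ob(3)] nth[OF ob(4) i]
              entry[OF h i] arr_cmp[OF entry[OF g] entry[OF f _ j] refl]]; simp)
        finally show ?thesis .
      qed
      then show "((h \<cdot>\<^bsub>?S\<^esub> g) \<cdot>\<^bsub>?S\<^esub> f) i j = (h \<cdot>\<^bsub>?S\<^esub> (g \<cdot>\<^bsub>?S\<^esub> f)) i j"
        unfolding sum_closure_cmp[OF sum_closure_arr_cmp[OF h g] f] sum_closure_cmp[OF h sum_closure_arr_cmp[OF g f]]
        unfolding sum_closure_cmp[OF h g] sum_closure_cmp[OF g f]
        by simp
    qed
  next
    have idn: "arr ?S X X 0 (idn ?S X)" if "X \<in> Obj ?S" for X
      using that nth[OF that] by (auto simp: arr_sum_closure arr_idn arr_zero)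
    then show "idn ?S X \<in> Hom ?S X X 0" if "X \<in> Obj ?S" for X
      using that by (simp add: arr_def)
    fix X Y f n
    assume ob: "X \<in> Obj ?S" "Y \<in> Obj ?S" and "f \<in> Hom ?S X Y n"
    then have f: "arr ?S X Y n f" by (simp add: arr_def)
    show "idn ?S Y \<cdot>\<^bsub>?S\<^esub> f = f"
    proof (intro ext)
      fix i j
      have "(\<Sum>k<length Y. (if i = k then idn A (Y ! i) else 0) \<cdot> f k j) = f i j"
        if i: "i < length Y" and j: "j < length X"
      proof -
        have "(\<Sum>k<length Y. (if i = k then idn A (Y ! i) else 0) \<cdot> f k j) =
            (\<Sum>k<length Y. if i = k then f k j else 0)"
          using i j by (intro sum.cong[OF refl]) (auto intro!: idn_cmp[OF entry[OF f]] zero_cmp[OF entry[OF f] nth[OF ob(2) i]])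
        then show ?thesis using i by simp
      qed
      then show "(idn ?S Y \<cdot>\<^bsub>?S\<^esub> f) i j = f i j"
        unfolding sum_closure_cmp[OF idn[OF ob(2)] f] using outside[OF f, of i j]
        by (cases "i < length Y \<and> j < length X") auto
    qed
    show "f \<cdot>\<^bsub>?S\<^esub> idn ?S X = f"
    proof (intro ext)
      fix i j
      have "(\<Sum>k<length X. f i k \<cdot> (if k = j \<and> k < length X then idn A (X ! k) else 0)) = f i j"
        if i: "i < length Y" and j: "j < length X"
      proof -
        have "(\<Sum>k<length X. f i k \<cdot> (if k = j \<and> k < length X then idn A (X ! k) else 0)) =
            (\<Sum>k<length X. if k = j then f i k else 0)"
          using i j by (intro sum.cong[OF refl]) (auto intro!: cmp_idn[OF entry[OF f]] cmp_zero[OF entry[OF f] nth[OF ob(1) j]])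
        then show ?thesis using j by simp
      qed
      then show "(f \<cdot>\<^bsub>?S\<^esub> idn ?S X) i j = f i j"
        unfolding sum_closure_cmp[OF f idn[OF ob(1)]] using outside[OF f, of i j]
        by (cases "i < length Y \<and> j < length X") auto
    qed
    show "dif ?S f \<in> Hom ?S X Y (n + 1)"
      using dif[OF f] by (simp add: arr_def)
    show "dif ?S (dif ?S f) = 0"
    proof (intro ext)
      fix i j
      show "dif ?S (dif ?S f) i j = 0 i j"
        using dif_dif_arr[OF entry[OF f, of i j]] outside[OF f, of i j]
        by (cases "i < length Y \<and> j < length X") (auto simp: zero)
    qed
    show "dif ?S (smul ?S c f) = smul ?S c (dif ?S f)" for c
    proof (intro ext)
      fix i j
      show "dif ?S (smul ?S c f) i j = smul ?S c (dif ?S f) i j"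
        using entry[OF f, of i j] outside[OF f, of i j] dif_smul
        by (cases "i < length Y \<and> j < length X") (auto simp: arr_def zero)
    qed
    fix f' assume "f' \<in> Hom ?S X Y n"
    then have f': "arr ?S X Y n f'" using ob by (simp add: arr_def)
    show "dif ?S (f + f') = dif ?S f + dif ?S f'"
    proof (intro ext)
      fix i j
      show "dif ?S (f + f') i j = (dif ?S f + dif ?S f') i j"
        using dif_add_arr[OF entry[OF f, of i j] entry[OF f', of i j]] outside[OF f, of i j] outside[OF f', of i j]
        by (cases "i < length Y \<and> j < length X") (auto simp: zero)
    qed
  qed
qed

end

section \<open>Small matrices and biproducts\<close>

lemma matrix_of_simps:
  "matrix_of [[x]] i j = (if i = 0 \<and> j = 0 then x else 0)"
  "matrix_of [[x], [y]] i j = (if i = 0 \<and> j = 0 then x else if i = 1 \<and> j = 0 then y else 0)"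
  "matrix_of [[x, y]] i j = (if i = 0 \<and> j = 0 then x else if i = 0 \<and> j = 1 then y else 0)"
  "matrix_of [[x, y], [z, w]] i j =
    (if i = 0 \<and> j = 0 then x else if i = 0 \<and> j = 1 then y else
     if i = 1 \<and> j = 0 then z else if i = 1 \<and> j = 1 then w else 0)"
  by (auto simp: matrix_of_def less_Suc_eq)

text \<open>The image of \<open>X\<close> under the full embedding that sends an object to its
  one-element list.\<close>

definition sum_complex ::
  "('o, 'm::zero) three_term \<Rightarrow> ('o list, nat \<Rightarrow> nat \<Rightarrow> 'm) three_term" where
  "sum_complex X = \<lparr>ob0 = [ob0 X], ob1 = [ob1 X], ob2 = [ob2 X],
    map_f = matrix_of [[map_f X]], map_j = matrix_of [[map_j X]], map_h = matrix_of [[map_h X]]\<rparr>"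

lemma sum_complex_simps [simp]:
  "ob0 (sum_complex X) = [ob0 X]" "ob1 (sum_complex X) = [ob1 X]" "ob2 (sum_complex X) = [ob2 X]"
  "map_f (sum_complex X) = matrix_of [[map_f X]]" "map_j (sum_complex X) = matrix_of [[map_j X]]"
  "map_h (sum_complex X) = matrix_of [[map_h X]]"
  by (simp_all add: sum_complex_def)

context dg_category
begin

text \<open>The identity is idempotent, so the Leibniz rule gives d(id) = d(id) + d(id).\<close>

lemma dif_idn: "X \<in> Obj A \<Longrightarrow> \<d> (idn A X) = 0"
  using dif_cmp[OF arr_idn arr_idn, of X] idn_cmp[OF arr_idn, of X] idn_cmp[OF arr_dif[OF arr_idn refl], of X]
    cmp_idn[OF arr_dif[OF arr_idn refl], of X] by simp

lemma arr_matrix_of: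
  "arr (sum_closure A) [X] [Y] n (matrix_of [[x]]) \<longleftrightarrow> arr A X Y n x"
  "arr (sum_closure A) [X] [Y, Z] n (matrix_of [[x], [y]]) \<longleftrightarrow> arr A X Y n x \<and> arr A X Z n y"
  "arr (sum_closure A) [Y, Z] [X] n (matrix_of [[x, y]]) \<longleftrightarrow> arr A Y X n x \<and> arr A Z X n y"
  "arr (sum_closure A) [X, Y] [Z, W] n (matrix_of [[x, y], [z, w]]) \<longleftrightarrow>
    arr A X Z n x \<and> arr A Y Z n y \<and> arr A X W n z \<and> arr A Y W n w"
  unfolding arr_sum_closure
  by (auto simp: matrix_of_simps less_Suc_eq all_conj_distrib nth_Cons' dest: arr_obj split: if_splits)

text \<open>Outside the index range the differential is applied to \<open>0\<close>, and an object
  of \<open>A\<close> is what guarantees that the result is \<open>0\<close>.\<close>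

lemma dif_matrix_of:
  assumes "Obj A \<noteq> {}"
  shows "dif (sum_closure A) (matrix_of [[x]]) = matrix_of [[\<d> x]]"
    "dif (sum_closure A) (matrix_of [[x], [y]]) = matrix_of [[\<d> x], [\<d> y]]"
    "dif (sum_closure A) (matrix_of [[x, y]]) = matrix_of [[\<d> x, \<d> y]]"
    "dif (sum_closure A) (matrix_of [[x, y], [z, w]]) = matrix_of [[\<d> x, \<d> y], [\<d> z, \<d> w]]"
  using assms dif_zero by (auto simp: fun_eq_iff matrix_of_simps)

text \<open>In the names of the following product rules, \<open>1\<close> is a single entry,
  \<open>21\<close> a column of two entries and \<open>12\<close> a row of two entries.\<close>

lemma cmp_matrix_of_1_1:
  "arr A Y Z n g \<Longrightarrow> arr A X Y m f \<Longrightarrow>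
    matrix_of [[g]] \<cdot>\<^bsub>sum_closure A\<^esub> matrix_of [[f]] = matrix_of [[g \<cdot> f]]"
  by (subst sum_closure_cmp[where xs = "[X]" and ys = "[Y]" and zs = "[Z]" and n = n and m = m])
    (auto simp: arr_matrix_of matrix_of_simps fun_eq_iff)

lemma cmp_matrix_of_21_1:
  "arr A Y Z n g \<Longrightarrow> arr A Y W n h \<Longrightarrow> arr A X Y m f \<Longrightarrow>
    matrix_of [[g], [h]] \<cdot>\<^bsub>sum_closure A\<^esub> matrix_of [[f]] = matrix_of [[g \<cdot> f], [h \<cdot> f]]"
  by (subst sum_closure_cmp[where xs = "[X]" and ys = "[Y]" and zs = "[Z, W]" and n = n and m = m])
    (auto simp: arr_matrix_of matrix_of_simps fun_eq_iff)

lemma cmp_matrix_of_1_12: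
  "arr A Y Z n g \<Longrightarrow> arr A X Y m f \<Longrightarrow> arr A W Y m h \<Longrightarrow>
    matrix_of [[g]] \<cdot>\<^bsub>sum_closure A\<^esub> matrix_of [[f, h]] = matrix_of [[g \<cdot> f, g \<cdot> h]]"
  by (subst sum_closure_cmp[where xs = "[X, W]" and ys = "[Y]" and zs = "[Z]" and n = n and m = m])
    (auto simp: arr_matrix_of matrix_of_simps fun_eq_iff)

lemma cmp_matrix_of_12_21:
  "arr A Y Z n g \<Longrightarrow> arr A Y' Z n g' \<Longrightarrow> arr A X Y m f \<Longrightarrow> arr A X Y' m f' \<Longrightarrow>
    matrix_of [[g, g']] \<cdot>\<^bsub>sum_closure A\<^esub> matrix_of [[f], [f']] = matrix_of [[g \<cdot> f + g' \<cdot> f']]"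
  by (subst sum_closure_cmp[where xs = "[X]" and ys = "[Y, Y']" and zs = "[Z]" and n = n and m = m])
    (auto simp: arr_matrix_of matrix_of_simps fun_eq_iff)

lemma cmp_matrix_of_21_12:
  "arr A Y Z n g \<Longrightarrow> arr A Y Z' n g' \<Longrightarrow> arr A X Y m f \<Longrightarrow> arr A X' Y m f' \<Longrightarrow>
    matrix_of [[g], [g']] \<cdot>\<^bsub>sum_closure A\<^esub> matrix_of [[f, f']] =
    matrix_of [[g \<cdot> f, g \<cdot> f'], [g' \<cdot> f, g' \<cdot> f']]"
  by (subst sum_closure_cmp[where xs = "[X, X']" and ys = "[Y]" and zs = "[Z, Z']" and n = n and m = m])
    (auto simp: arr_matrix_of matrix_of_simps fun_eq_iff)

text \<open>The biproduct identities hold in \<open>A\<close> only up to boundaries, while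
  \<open>[X, Y]\<close> is a strict direct sum. Read as matrix equations, these identities say that
  the projections and the inclusions are mutually inverse up to homotopy.\<close>

lemma biproduct_h_equivalence:
  assumes D: "biproduct_H0 A X Y D \<iota>\<^sub>1 \<iota>\<^sub>2 \<pi>\<^sub>1 \<pi>\<^sub>2" and X: "X \<in> Obj A" and Y: "Y \<in> Obj A"
  shows "h_equivalence (sum_closure A) [D] [X, Y] (matrix_of [[\<pi>\<^sub>1], [\<pi>\<^sub>2]]) (matrix_of [[\<iota>\<^sub>1, \<iota>\<^sub>2]])"
proof -
  let ?S = "sum_closure A"
  have obj: "D \<in> Obj A" "Obj A \<noteq> {}" using D by (auto simp: biproduct_H0_def)
  have a: "arr A X D 0 \<iota>\<^sub>1" "arr A Y D 0 \<iota>\<^sub>2" "arr A D X 0 \<pi>\<^sub>1" "arr A D Y 0 \<pi>\<^sub>2"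
    and d: "\<d> \<iota>\<^sub>1 = 0" "\<d> \<iota>\<^sub>2 = 0" "\<d> \<pi>\<^sub>1 = 0" "\<d> \<pi>\<^sub>2 = 0"
    using D X Y by (auto simp: biproduct_H0_def Z0_def arr_def)
  \<comment> \<open>One primitive for each of the five identities: the first four are the entries of
    the homotopy on \<open>[X, Y]\<close>, the last is the homotopy on \<open>D\<close>.\<close>
  obtain \<alpha> \<beta> \<gamma> \<delta> \<theta> where h: "arr A X X (-1) \<alpha>" "arr A Y X (-1) \<beta>" "arr A X Y (-1) \<gamma>" "arr A Y Y (-1) \<delta>"
      "arr A D D (-1) \<theta>"
    and e: "\<pi>\<^sub>1 \<cdot> \<iota>\<^sub>1 - idn A X = \<d> \<alpha>" "\<pi>\<^sub>1 \<cdot> \<iota>\<^sub>2 = \<d> \<beta>" "\<pi>\<^sub>2 \<cdot> \<iota>\<^sub>1 = \<d> \<gamma>" "\<pi>\<^sub>2 \<cdot> \<iota>\<^sub>2 - idn A Y = \<d> \<delta>"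
      "\<iota>\<^sub>1 \<cdot> \<pi>\<^sub>1 + \<iota>\<^sub>2 \<cdot> \<pi>\<^sub>2 - idn A D = \<d> \<theta>"
    using D X Y by (auto simp: biproduct_H0_def eq_H0_def arr_def)
  have "matrix_of [[\<iota>\<^sub>1, \<iota>\<^sub>2]] \<cdot>\<^bsub>?S\<^esub> matrix_of [[\<pi>\<^sub>1], [\<pi>\<^sub>2]] - idn ?S [D] = dif ?S (matrix_of [[\<theta>]])"
    unfolding cmp_matrix_of_12_21[OF a] dif_matrix_of[OF obj(2)] by (simp add: fun_eq_iff matrix_of_simps flip: e)
  moreover have "matrix_of [[\<pi>\<^sub>1], [\<pi>\<^sub>2]] \<cdot>\<^bsub>?S\<^esub> matrix_of [[\<iota>\<^sub>1, \<iota>\<^sub>2]] - idn ?S [X, Y] =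
      dif ?S (matrix_of [[\<alpha>, \<beta>], [\<gamma>, \<delta>]])"
    unfolding cmp_matrix_of_21_12[OF a(3,4,1,2)] dif_matrix_of[OF obj(2)]
    by (auto simp: fun_eq_iff matrix_of_simps less_Suc_eq simp flip: e)
  moreover have "matrix_of [[0], [0]] = (0 :: nat \<Rightarrow> nat \<Rightarrow> 'm)" "matrix_of [[0, 0]] = (0 :: nat \<Rightarrow> nat \<Rightarrow> 'm)"
    by (simp_all add: fun_eq_iff matrix_of_simps)
  then have "dif ?S (matrix_of [[\<pi>\<^sub>1], [\<pi>\<^sub>2]]) = 0" "dif ?S (matrix_of [[\<iota>\<^sub>1, \<iota>\<^sub>2]]) = 0"
    unfolding dif_matrix_of[OF obj(2)] d .
  moreover have "arr ?S [D] [D] (-1) (matrix_of [[\<theta>]])" "arr ?S [X, Y] [X, Y] (-1) (matrix_of [[\<alpha>, \<beta>], [\<gamma>, \<delta>]])"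
    "arr ?S [D] [X, Y] 0 (matrix_of [[\<pi>\<^sub>1], [\<pi>\<^sub>2]])" "arr ?S [X, Y] [D] 0 (matrix_of [[\<iota>\<^sub>1, \<iota>\<^sub>2]])"
    using a h by (simp_all add: arr_matrix_of)
  ultimately show ?thesis
    unfolding h_equivalence_def by blast
qed

lemma h_equivalence_sym: "h_equivalence A X Y g g' \<Longrightarrow> h_equivalence A Y X g' g"
  by (simp add: h_equivalence_def)

section \<open>Passage of homotopy exactness to the closure under direct sums\<close>

lemma h_complex_sum_complex: "h_complex A X \<Longrightarrow> h_complex (sum_closure A) (sum_complex X)"
proof -
  assume X: "h_complex A X"
  note c = h_complex_arr[OF X]
  interpret S: dg_category "sum_closure A" using dg_category_sum_closure arr_obj[OF c(1)] by blast
  have ob: "Obj A \<noteq> {}" using arr_obj[OF c(1)] by blast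
  have z: "matrix_of [[0]] = (0 :: nat \<Rightarrow> nat \<Rightarrow> 'm)" "matrix_of [[- x]] = - matrix_of [[x :: 'm]]" for x
    by (simp_all add: fun_eq_iff matrix_of_simps)
  have "arr (sum_closure A) [ob0 X] [ob1 X] 0 (matrix_of [[map_f X]])"
    "arr (sum_closure A) [ob1 X] [ob2 X] 0 (matrix_of [[map_j X]])"
    "arr (sum_closure A) [ob0 X] [ob2 X] (-1) (matrix_of [[map_h X]])"
    using c by (simp_all add: arr_matrix_of)
  then show ?thesis
    using dif_matrix_of(1)[OF ob] c z cmp_matrix_of_1_1[OF c(2,1)]
    by (simp add: h_complex_def Z0_def arr_def)
qed

text \<open>Morphisms from a list \<open>ys\<close> to a one-element list are rows, one entry for
  each member of \<open>ys\<close>, and composition with a one-by-one matrix and the differential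
  act entrywise. So exactness at \<open>ys\<close> is the conjunction of exactness at its
  members.\<close>

lemma h_left_exact_sum_complex:
  assumes X: "h_left_exact A X"
  shows "h_left_exact (sum_closure A) (sum_complex X)"
proof -
  let ?S = "sum_closure A" and ?f = "map_f X" and ?j = "map_j X" and ?h = "map_h X"
  have cX: "h_complex A X" using X by (simp add: h_left_exact_iff)
  note c = h_complex_arr[OF cX]
  interpret S: dg_category ?S using dg_category_sum_closure arr_obj[OF c(1)] by blast
  have z: "\<d> 0 = 0" using dif_zero arr_obj[OF c(1)] by blast
  have left: "matrix_of [[g]] \<cdot>\<^bsub>?S\<^esub> u = (\<lambda>i j. if i = 0 \<and> j < length ys then g \<cdot> u 0 j else 0)"
    if "arr A Y Z n g" "arr ?S ys [Y] m u" for Y Z n g ys m u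
    using that by (subst sum_closure_cmp[where xs = ys and ys = "[Y]" and zs = "[Z]" and n = n and m = m])
      (auto simp: arr_matrix_of matrix_of_simps fun_eq_iff)
  have row: "arr ?S ys [Y] n u \<longleftrightarrow> ys \<in> lists (Obj A) \<and> Y \<in> Obj A \<and>
      (\<forall>j < length ys. arr A (ys ! j) Y n (u 0 j)) \<and> (\<forall>i j. \<not> (i = 0 \<and> j < length ys) \<longrightarrow> u i j = 0)" for ys Y n u
    by (auto simp: arr_sum_closure split: if_splits)
  have "left_exact_at ?S (sum_complex X) ys n" if ys: "ys \<in> Obj ?S" "n \<le> 0" for ys n
  proof -
    have exact: "left_exact_at A X (ys ! k) n" if "k < length ys" for k
      using X ys that by (auto simp: h_left_exact_iff in_lists_conv_set)
    show ?thesis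
      unfolding left_exact_at_def
    proof (intro conjI allI impI; simp only: sum_complex_simps)
      fix u v w
      assume H: "arr ?S ys [ob0 X] n u \<and> dif ?S u = 0 \<and> arr ?S ys [ob1 X] (n - 1) v \<and> arr ?S ys [ob2 X] (n - 2) w \<and>
        matrix_of [[?f]] \<cdot>\<^bsub>?S\<^esub> u = dif ?S v \<and>
        matrix_of [[?h]] \<cdot>\<^bsub>?S\<^esub> u = - dif ?S w - matrix_of [[?j]] \<cdot>\<^bsub>?S\<^esub> v"
      then have t: "arr ?S ys [ob0 X] n u" "arr ?S ys [ob1 X] (n - 1) v" "arr ?S ys [ob2 X] (n - 2) w"
        by simp_all
      have "\<exists>u'. arr A (ys ! k) (ob0 X) (n - 1) u' \<and> u 0 k = \<d> u'" if k: "k < length ys" for k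
      proof -
        have "\<d> (u 0 k) = 0" using H by (simp add: fun_eq_iff)
        moreover have "?f \<cdot> u 0 k = \<d> (v 0 k)"
          using H k fun_cong[OF fun_cong[OF left[OF c(1) t(1)]], of 0 k] by simp
        moreover have "?h \<cdot> u 0 k = - \<d> (w 0 k) - ?j \<cdot> v 0 k"
          using H k fun_cong[OF fun_cong[OF left[OF c(3) t(1)]], of 0 k]
            fun_cong[OF fun_cong[OF left[OF c(2) t(2)]], of 0 k] by simp
        moreover have "arr A (ys ! k) (ob0 X) n (u 0 k)" "arr A (ys ! k) (ob1 X) (n - 1) (v 0 k)"
          "arr A (ys ! k) (ob2 X) (n - 2) (w 0 k)"
          using t k by (simp_all add: row)
        ultimately show ?thesis
          using exact[OF k] unfolding left_exact_at_def by blast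
      qed
      then obtain U where U: "\<And>k. k < length ys \<Longrightarrow> arr A (ys ! k) (ob0 X) (n - 1) (U k) \<and> u 0 k = \<d> (U k)"
        by metis
      \<comment> \<open>The chosen primitives form a row, extended by zero outside the index range
        as the Hom sets of the closure demand.\<close>
      let ?u = "\<lambda>i k. if i = (0::nat) \<and> k < length ys then U k else 0"
      have "arr ?S ys [ob0 X] (n - 1) ?u" using U t(1) by (simp add: row)
      moreover have "u = dif ?S ?u" using U t(1) by (auto simp: fun_eq_iff row z)
      ultimately show "\<exists>u'. arr ?S ys [ob0 X] (n - 1) u' \<and> u = dif ?S u'" by blast
    next
      fix v w
      assume H: "arr ?S ys [ob1 X] n v \<and> dif ?S v = 0 \<and> arr ?S ys [ob2 X] (n - 1) w \<and>
        dif ?S w = - (matrix_of [[?j]] \<cdot>\<^bsub>?S\<^esub> v)"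
      then have t: "arr ?S ys [ob1 X] n v" "arr ?S ys [ob2 X] (n - 1) w" by simp_all
      have "\<exists>u v' w'. arr A (ys ! k) (ob0 X) n u \<and> \<d> u = 0 \<and> arr A (ys ! k) (ob1 X) (n - 1) v' \<and>
          arr A (ys ! k) (ob2 X) (n - 2) w' \<and> v 0 k - ?f \<cdot> u = \<d> v' \<and> w 0 k - ?h \<cdot> u = - \<d> w' - ?j \<cdot> v'"
        if k: "k < length ys" for k
      proof -
        have "\<d> (v 0 k) = 0" using H by (simp add: fun_eq_iff)
        moreover have "\<d> (w 0 k) = - (?j \<cdot> v 0 k)"
          using H k fun_cong[OF fun_cong[OF left[OF c(2) t(1)]], of 0 k] by (simp add: fun_eq_iff)
        moreover have "arr A (ys ! k) (ob1 X) n (v 0 k)" "arr A (ys ! k) (ob2 X) (n - 1) (w 0 k)"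
          using t k by (simp_all add: row)
        ultimately show ?thesis
          using exact[OF k] unfolding left_exact_at_def by blast
      qed
      then obtain U V W where U: "\<And>k. k < length ys \<Longrightarrow> arr A (ys ! k) (ob0 X) n (U k) \<and> \<d> (U k) = 0 \<and>
          arr A (ys ! k) (ob1 X) (n - 1) (V k) \<and> arr A (ys ! k) (ob2 X) (n - 2) (W k) \<and>
          v 0 k - ?f \<cdot> U k = \<d> (V k) \<and> w 0 k - ?h \<cdot> U k = - \<d> (W k) - ?j \<cdot> V k"
        by metis
      let ?r = "\<lambda>U i k. if i = (0::nat) \<and> k < length ys then U k else 0"
      have a: "arr ?S ys [ob0 X] n (?r U)" "arr ?S ys [ob1 X] (n - 1) (?r V)" "arr ?S ys [ob2 X] (n - 2) (?r W)"
        using U t c ys(1) by (simp_all add: row arr_obj(1)[OF c(1)])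
      moreover have "dif ?S (?r U) = 0" using U by (auto simp: fun_eq_iff z)
      moreover have "v - matrix_of [[?f]] \<cdot>\<^bsub>?S\<^esub> ?r U = dif ?S (?r V)"
        unfolding left[OF c(1) a(1)] using U t by (auto simp: fun_eq_iff z row)
      moreover have "w - matrix_of [[?h]] \<cdot>\<^bsub>?S\<^esub> ?r U = - dif ?S (?r W) - matrix_of [[?j]] \<cdot>\<^bsub>?S\<^esub> ?r V"
        unfolding left[OF c(3) a(1)] left[OF c(2) a(2)] using U t by (auto simp: fun_eq_iff z row)
      ultimately show "\<exists>u v' w'. arr ?S ys [ob0 X] n u \<and> dif ?S u = 0 \<and> arr ?S ys [ob1 X] (n - 1) v' \<and>
          arr ?S ys [ob2 X] (n - 2) w' \<and> v - matrix_of [[?f]] \<cdot>\<^bsub>?S\<^esub> u = dif ?S v' \<and>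
          w - matrix_of [[?h]] \<cdot>\<^bsub>?S\<^esub> u = - dif ?S w' - matrix_of [[?j]] \<cdot>\<^bsub>?S\<^esub> v'"
        by blast
    qed
  qed
  then show ?thesis
    using h_complex_sum_complex[OF cX] by (simp add: S.h_left_exact_iff)
qed

text \<open>Dual to the left exact case: morphisms from a one-element list to \<open>ys\<close> are
  columns, and the sign \<open>koszul n\<close> also acts entrywise.\<close>

lemma h_right_exact_sum_complex:
  assumes X: "h_right_exact A X"
  shows "h_right_exact (sum_closure A) (sum_complex X)"
proof -
  let ?S = "sum_closure A" and ?f = "map_f X" and ?j = "map_j X" and ?h = "map_h X"
  have cX: "h_complex A X" using X by (simp add: h_right_exact_iff)
  note c = h_complex_arr[OF cX]
  interpret S: dg_category ?S using dg_category_sum_closure arr_obj[OF c(1)] by blast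
  have z: "\<d> 0 = 0" using dif_zero arr_obj[OF c(1)] by blast
  have right: "u \<cdot>\<^bsub>?S\<^esub> matrix_of [[g]] = (\<lambda>i j. if j = 0 \<and> i < length ys then u i 0 \<cdot> g else 0)"
    if "arr A Z Y n g" "arr ?S [Y] ys m u" for Y Z n g ys m u
    using that by (subst sum_closure_cmp[where zs = ys and ys = "[Y]" and xs = "[Z]" and n = m and m = n])
      (auto simp: arr_matrix_of matrix_of_simps fun_eq_iff)
  have column: "arr ?S [Y] ys n u \<longleftrightarrow> ys \<in> lists (Obj A) \<and> Y \<in> Obj A \<and>
      (\<forall>i < length ys. arr A Y (ys ! i) n (u i 0)) \<and> (\<forall>i j. \<not> (j = 0 \<and> i < length ys) \<longrightarrow> u i j = 0)" for ys Y n u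
    by (auto simp: arr_sum_closure split: if_splits)
  have "right_exact_at ?S (sum_complex X) ys n" if ys: "ys \<in> Obj ?S" "n \<le> 0" for ys n
  proof -
    have exact: "right_exact_at A X (ys ! k) n" if "k < length ys" for k
      using X ys that by (auto simp: h_right_exact_iff in_lists_conv_set)
    show ?thesis
      unfolding right_exact_at_def
    proof (intro conjI allI impI; simp only: sum_complex_simps)
      fix u v w
      assume H: "arr ?S [ob2 X] ys n u \<and> dif ?S u = 0 \<and> arr ?S [ob1 X] ys (n - 1) v \<and> arr ?S [ob0 X] ys (n - 2) w \<and>
        u \<cdot>\<^bsub>?S\<^esub> matrix_of [[?j]] = dif ?S v \<and>
        koszul n (u \<cdot>\<^bsub>?S\<^esub> matrix_of [[?h]]) = - dif ?S w - v \<cdot>\<^bsub>?S\<^esub> matrix_of [[?f]]"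
      then have t: "arr ?S [ob2 X] ys n u" "arr ?S [ob1 X] ys (n - 1) v" "arr ?S [ob0 X] ys (n - 2) w"
        by simp_all
      have "\<exists>u'. arr A (ob2 X) (ys ! k) (n - 1) u' \<and> u k 0 = \<d> u'" if k: "k < length ys" for k
      proof -
        have "\<d> (u k 0) = 0" using H by (simp add: fun_eq_iff)
        moreover have "u k 0 \<cdot> ?j = \<d> (v k 0)"
          using H k fun_cong[OF fun_cong[OF right[OF c(2) t(1)]], of k 0] by simp
        moreover have "koszul n (u k 0 \<cdot> ?h) = - \<d> (w k 0) - v k 0 \<cdot> ?f"
          using H k fun_cong[OF fun_cong[OF right[OF c(3) t(1)]], of k 0]
            fun_cong[OF fun_cong[OF right[OF c(1) t(2)]], of k 0]
            koszul_fun[of n "u \<cdot>\<^bsub>?S\<^esub> matrix_of [[?h]]" k 0] by simp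
        moreover have "arr A (ob2 X) (ys ! k) n (u k 0)" "arr A (ob1 X) (ys ! k) (n - 1) (v k 0)"
          "arr A (ob0 X) (ys ! k) (n - 2) (w k 0)"
          using t k by (simp_all add: column)
        ultimately show ?thesis
          using exact[OF k] unfolding right_exact_at_def by blast
      qed
      then obtain U where U: "\<And>k. k < length ys \<Longrightarrow> arr A (ob2 X) (ys ! k) (n - 1) (U k) \<and> u k 0 = \<d> (U k)"
        by metis
      let ?u = "\<lambda>k j. if j = (0::nat) \<and> k < length ys then U k else 0"
      have "arr ?S [ob2 X] ys (n - 1) ?u" using U t(1) by (simp add: column)
      moreover have "u = dif ?S ?u" using U t(1) by (auto simp: fun_eq_iff column z)
      ultimately show "\<exists>u'. arr ?S [ob2 X] ys (n - 1) u' \<and> u = dif ?S u'" by blast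
    next
      fix v w
      assume H: "arr ?S [ob1 X] ys n v \<and> dif ?S v = 0 \<and> arr ?S [ob0 X] ys (n - 1) w \<and>
        dif ?S w = - (v \<cdot>\<^bsub>?S\<^esub> matrix_of [[?f]])"
      then have t: "arr ?S [ob1 X] ys n v" "arr ?S [ob0 X] ys (n - 1) w" by simp_all
      have "\<exists>u v' w'. arr A (ob2 X) (ys ! k) n u \<and> \<d> u = 0 \<and> arr A (ob1 X) (ys ! k) (n - 1) v' \<and>
          arr A (ob0 X) (ys ! k) (n - 2) w' \<and> v k 0 - u \<cdot> ?j = \<d> v' \<and>
          w k 0 - koszul n (u \<cdot> ?h) = - \<d> w' - v' \<cdot> ?f"
        if k: "k < length ys" for k
      proof -
        have "\<d> (v k 0) = 0" using H by (simp add: fun_eq_iff)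
        moreover have "\<d> (w k 0) = - (v k 0 \<cdot> ?f)"
          using H k fun_cong[OF fun_cong[OF right[OF c(1) t(1)]], of k 0] by (simp add: fun_eq_iff)
        moreover have "arr A (ob1 X) (ys ! k) n (v k 0)" "arr A (ob0 X) (ys ! k) (n - 1) (w k 0)"
          using t k by (simp_all add: column)
        ultimately show ?thesis
          using exact[OF k] unfolding right_exact_at_def by blast
      qed
      then obtain U V W where U: "\<And>k. k < length ys \<Longrightarrow> arr A (ob2 X) (ys ! k) n (U k) \<and> \<d> (U k) = 0 \<and>
          arr A (ob1 X) (ys ! k) (n - 1) (V k) \<and> arr A (ob0 X) (ys ! k) (n - 2) (W k) \<and>
          v k 0 - U k \<cdot> ?j = \<d> (V k) \<and> w k 0 - koszul n (U k \<cdot> ?h) = - \<d> (W k) - V k \<cdot> ?f"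
        by metis
      let ?r = "\<lambda>U k j. if j = (0::nat) \<and> k < length ys then U k else 0"
      have a: "arr ?S [ob2 X] ys n (?r U)" "arr ?S [ob1 X] ys (n - 1) (?r V)" "arr ?S [ob0 X] ys (n - 2) (?r W)"
        using U t c ys(1) by (simp_all add: column arr_obj(2)[OF c(2)])
      moreover have "dif ?S (?r U) = 0" using U by (auto simp: fun_eq_iff z)
      moreover have "v - ?r U \<cdot>\<^bsub>?S\<^esub> matrix_of [[?j]] = dif ?S (?r V)"
        unfolding right[OF c(2) a(1)] using U t by (auto simp: fun_eq_iff z column)
      moreover have "w - koszul n (?r U \<cdot>\<^bsub>?S\<^esub> matrix_of [[?h]]) = - dif ?S (?r W) - ?r V \<cdot>\<^bsub>?S\<^esub> matrix_of [[?f]]"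
        unfolding right[OF c(3) a(1)] right[OF c(1) a(2)] using U t by (auto simp: fun_eq_iff z column koszul_fun)
      ultimately show "\<exists>u v' w'. arr ?S [ob2 X] ys n u \<and> dif ?S u = 0 \<and> arr ?S [ob1 X] ys (n - 1) v' \<and>
          arr ?S [ob0 X] ys (n - 2) w' \<and> v - u \<cdot>\<^bsub>?S\<^esub> matrix_of [[?j]] = dif ?S v' \<and>
          w - koszul n (u \<cdot>\<^bsub>?S\<^esub> matrix_of [[?h]]) = - dif ?S w' - v' \<cdot>\<^bsub>?S\<^esub> matrix_of [[?f]]"
        by blast
    qed
  qed
  then show ?thesis
    using h_complex_sum_complex[OF cX] by (simp add: S.h_right_exact_iff)
qed

end

section \<open>Stable dg categories\<close>

context dg_category
begin

text \<open>With j = p\<pi>1 - c\<pi>2, p' = \<pi>2 f and b = \<pi>1 f, the equation d(h) = -jf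
  becomes d(h) = cp' - pb. So the homotopy of the kernel serves unchanged as the homotopy of the
  square.\<close>

lemma h_cartesian_of_kernel:
  assumes D: "biproduct_H0 A B C' D \<iota>\<^sub>1 \<iota>\<^sub>2 \<pi>\<^sub>1 \<pi>\<^sub>2" and obj: "B \<in> Obj A" "C' \<in> Obj A" "C \<in> Obj A"
    and p: "p \<in> Z0 A B C" and c: "c \<in> Z0 A C' C"
    and X: "h_kernel A D C (p \<cdot> \<pi>\<^sub>1 - c \<cdot> \<pi>\<^sub>2) X"
  shows "h_cartesian A \<lparr>sq_B' = ob0 X, sq_C' = C', sq_B = B, sq_C = C, sq_p' = \<pi>\<^sub>2 \<cdot> map_f X,
    sq_b = \<pi>\<^sub>1 \<cdot> map_f X, sq_c = c, sq_p = p, sq_s = map_h X\<rparr>" (is "h_cartesian A ?Q")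
proof -
  let ?S = "sum_closure A" and ?f = "map_f X"
  have le: "h_left_exact A X" and ob: "ob1 X = D" "ob2 X = C" and j: "map_j X = p \<cdot> \<pi>\<^sub>1 - c \<cdot> \<pi>\<^sub>2"
    using X by (simp_all add: h_kernel_def)
  then have cX: "h_complex A X" by (simp add: h_left_exact_iff)
  note cx = h_complex_arr[OF cX, unfolded ob]
  have ne: "Obj A \<noteq> {}" using obj by blast
  interpret S: dg_category ?S by (rule dg_category_sum_closure[OF ne])
  have \<pi>: "arr A D B 0 \<pi>\<^sub>1" "arr A D C' 0 \<pi>\<^sub>2" "\<d> \<pi>\<^sub>1 = 0" "\<d> \<pi>\<^sub>2 = 0"
    using D obj by (simp_all add: biproduct_H0_def Z0_def arr_def)
  have p': "arr A B C 0 p" "\<d> p = 0" and c': "arr A C' C 0 c" "\<d> c = 0"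
    using p c obj by (simp_all add: Z0_def arr_def)
  have nc: "arr A C' C 0 (- c)" "\<d> (- c) = 0" using arr_minus[OF c'(1)] dif_minus[OF c'(1)] c'(2) by simp_all
  have \<pi>f: "arr A (ob0 X) B 0 (\<pi>\<^sub>1 \<cdot> ?f)" "arr A (ob0 X) C' 0 (\<pi>\<^sub>2 \<cdot> ?f)"
    using arr_cmp[OF \<pi>(1) cx(1)] arr_cmp[OF \<pi>(2) cx(1)] by simp_all
  have d\<pi>f: "\<d> (\<pi>\<^sub>1 \<cdot> ?f) = 0" "\<d> (\<pi>\<^sub>2 \<cdot> ?f) = 0"
    using dif_cmp_closed_right[OF \<pi>(1) cx(1,4)] dif_cmp_closed_right[OF \<pi>(2) cx(1,4)] \<pi>(3,4)
      zero_cmp[OF cx(1)] obj by simp_all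
  have "map_j X \<cdot> ?f = p \<cdot> (\<pi>\<^sub>1 \<cdot> ?f) - c \<cdot> (\<pi>\<^sub>2 \<cdot> ?f)"
    unfolding j using diff_cmp[OF arr_cmp[OF p'(1) \<pi>(1) refl] arr_cmp[OF c'(1) \<pi>(2) refl] cx(1)]
      cmp_assoc_arr[OF p'(1) \<pi>(1) cx(1)] cmp_assoc_arr[OF c'(1) \<pi>(2) cx(1)] by simp
  then have sq: "h_square A ?Q"
    using obj cx \<pi>f d\<pi>f p c by (simp add: h_square_def Z0_def arr_def)
  have "arr ?S [B, C'] [C] 0 (matrix_of [[p, - c]])" using p'(1) nc(1) by (simp add: arr_matrix_of)
  moreover have "dif ?S (matrix_of [[p, - c]]) = 0"
    unfolding dif_matrix_of[OF ne] p'(2) nc(2) by (simp add: fun_eq_iff matrix_of_simps)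
  moreover have "matrix_of [[map_j X]] = matrix_of [[p, - c]] \<cdot>\<^bsub>?S\<^esub> matrix_of [[\<pi>\<^sub>1], [\<pi>\<^sub>2]]"
    using minus_cmp[OF c'(1) \<pi>(2)] by (simp add: cmp_matrix_of_12_21[OF p'(1) nc(1) \<pi>(1,2)] j)
  ultimately have "h_left_exact ?S (sum_complex X
      \<lparr>ob1 := [B, C'], map_f := matrix_of [[\<pi>\<^sub>1], [\<pi>\<^sub>2]] \<cdot>\<^bsub>?S\<^esub> matrix_of [[?f]], map_j := matrix_of [[p, - c]]\<rparr>)"
    using S.h_left_exact_middle[OF h_left_exact_sum_complex[OF le]] biproduct_h_equivalence[OF D obj(1,2)] ob by simp
  moreover have "sum_complex X
      \<lparr>ob1 := [B, C'], map_f := matrix_of [[\<pi>\<^sub>1], [\<pi>\<^sub>2]] \<cdot>\<^bsub>?S\<^esub> matrix_of [[?f]], map_j := matrix_of [[p, - c]]\<rparr> =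
      square_complex ?Q"
    unfolding cmp_matrix_of_21_1[OF \<pi>(1,2) cx(1)] by (simp add: sum_complex_def square_complex_def ob)
  ultimately show ?thesis
    using sq by (simp add: h_cartesian_def)
qed

text \<open>Now the map out of \<open>B'\<close> factors strictly, as the column with entries
  \<open>b\<close>, \<open>p'\<close> followed by the row of inclusions. The row of a square complex
  is [p, -c], which forces the sign in \<open>sq_c\<close>; with it, d(h) = -jf becomes d(h) = cp' -
  pb.\<close>

lemma h_cocartesian_of_cokernel:
  assumes D: "biproduct_H0 A B C' D \<iota>\<^sub>1 \<iota>\<^sub>2 \<pi>\<^sub>1 \<pi>\<^sub>2" and obj: "B \<in> Obj A" "C' \<in> Obj A" "B' \<in> Obj A"
    and b: "b \<in> Z0 A B' B" and p': "p' \<in> Z0 A B' C'"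
    and X: "h_cokernel A B' D (\<iota>\<^sub>1 \<cdot> b + \<iota>\<^sub>2 \<cdot> p') X"
  shows "h_cocartesian A \<lparr>sq_B' = B', sq_C' = C', sq_B = B, sq_C = ob2 X, sq_p' = p',
    sq_b = b, sq_c = - (map_j X \<cdot> \<iota>\<^sub>2), sq_p = map_j X \<cdot> \<iota>\<^sub>1, sq_s = map_h X\<rparr>" (is "h_cocartesian A ?Q")
proof -
  let ?S = "sum_closure A" and ?j = "map_j X"
  have re: "h_right_exact A X" and ob: "ob0 X = B'" "ob1 X = D" and f: "map_f X = \<iota>\<^sub>1 \<cdot> b + \<iota>\<^sub>2 \<cdot> p'"
    using X by (simp_all add: h_cokernel_def)
  then have cX: "h_complex A X" by (simp add: h_right_exact_iff)
  note cx = h_complex_arr[OF cX, unfolded ob]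
  have ne: "Obj A \<noteq> {}" using obj by blast
  interpret S: dg_category ?S by (rule dg_category_sum_closure[OF ne])
  have \<iota>: "arr A B D 0 \<iota>\<^sub>1" "arr A C' D 0 \<iota>\<^sub>2" "\<d> \<iota>\<^sub>1 = 0" "\<d> \<iota>\<^sub>2 = 0"
    using D obj by (simp_all add: biproduct_H0_def Z0_def arr_def)
  have b': "arr A B' B 0 b" "\<d> b = 0" and p'': "arr A B' C' 0 p'" "\<d> p' = 0"
    using b p' obj by (simp_all add: Z0_def arr_def)
  have j\<iota>: "arr A B (ob2 X) 0 (?j \<cdot> \<iota>\<^sub>1)" "arr A C' (ob2 X) 0 (?j \<cdot> \<iota>\<^sub>2)"
    using arr_cmp[OF cx(2) \<iota>(1)] arr_cmp[OF cx(2) \<iota>(2)] by simp_all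
  have dj\<iota>: "\<d> (?j \<cdot> \<iota>\<^sub>1) = 0" "\<d> (?j \<cdot> \<iota>\<^sub>2) = 0"
    using dif_cmp_closed_right[OF cx(2) \<iota>(1,3)] dif_cmp_closed_right[OF cx(2) \<iota>(2,4)] cx(5)
      zero_cmp[OF \<iota>(1)] zero_cmp[OF \<iota>(2)] arr_obj[OF cx(2)] by simp_all
  have "?j \<cdot> map_f X = (?j \<cdot> \<iota>\<^sub>1) \<cdot> b + (?j \<cdot> \<iota>\<^sub>2) \<cdot> p'"
    unfolding f using cmp_add[OF cx(2) arr_cmp[OF \<iota>(1) b'(1) refl] arr_cmp[OF \<iota>(2) p''(1) refl]]
      cmp_assoc_arr[OF cx(2) \<iota>(1) b'(1)] cmp_assoc_arr[OF cx(2) \<iota>(2) p''(1)] by simp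
  then have sq: "h_square A ?Q"
    using obj cx j\<iota> dj\<iota> b p' arr_minus[OF j\<iota>(2)] dif_minus[OF j\<iota>(2)] minus_cmp[OF j\<iota>(2) p''(1)]
    by (simp add: h_square_def Z0_def arr_def)
  have "arr ?S [B'] [B, C'] 0 (matrix_of [[b], [p']])" using b'(1) p''(1) by (simp add: arr_matrix_of)
  moreover have "dif ?S (matrix_of [[b], [p']]) = 0"
    unfolding dif_matrix_of[OF ne] b'(2) p''(2) by (simp add: fun_eq_iff matrix_of_simps)
  moreover have "matrix_of [[map_f X]] = matrix_of [[\<iota>\<^sub>1, \<iota>\<^sub>2]] \<cdot>\<^bsub>?S\<^esub> matrix_of [[b], [p']]"
    by (simp add: cmp_matrix_of_12_21[OF \<iota>(1,2) b'(1) p''(1)] f)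
  ultimately have "h_right_exact ?S (sum_complex X
      \<lparr>ob1 := [B, C'], map_f := matrix_of [[b], [p']], map_j := matrix_of [[?j]] \<cdot>\<^bsub>?S\<^esub> matrix_of [[\<iota>\<^sub>1, \<iota>\<^sub>2]]\<rparr>)"
    \<comment> \<open>The new middle object \<open>[B, C']\<close> has to map to the old one, so the
      equivalence is taken in the direction of the inclusions.\<close>
    using S.h_right_exact_middle[OF h_right_exact_sum_complex[OF re]]
      S.h_equivalence_sym[OF biproduct_h_equivalence[OF D obj(1,2)]] ob by simp
  moreover have "sum_complex X
      \<lparr>ob1 := [B, C'], map_f := matrix_of [[b], [p']], map_j := matrix_of [[?j]] \<cdot>\<^bsub>?S\<^esub> matrix_of [[\<iota>\<^sub>1, \<iota>\<^sub>2]]\<rparr> =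
      square_complex ?Q"
    unfolding cmp_matrix_of_1_12[OF cx(2) \<iota>(1,2)] by (simp add: sum_complex_def square_complex_def ob)
  ultimately show ?thesis
    using sq by (simp add: h_cocartesian_def)
qed

end

section \<open>Deflations, inflations and the axioms of an exact structure\<close>

lemma stable_dg_deflation:
  assumes A: "stable_dg A" and f: "P \<in> Obj A" "Q \<in> Obj A" "f \<in> Z0 A P Q"
  shows "deflation {X. h_short_exact A X} P Q f"
proof -
  obtain X where X: "h_kernel A P Q f X"
    using A f unfolding stable_dg_def by blast
  then have "h_short_exact A X"
    using A by (auto simp: h_kernel_def h_short_exact_def stable_dg_def h_left_exact_def)
  then show ?thesis
    using X by (auto simp: deflation_def h_kernel_def)
qed

lemma stable_dg_inflation:
  assumes A: "stable_dg A" and f: "P \<in> Obj A" "Q \<in> Obj A" "f \<in> Z0 A P Q"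
  shows "inflation {X. h_short_exact A X} P Q f"
proof -
  obtain X where X: "h_cokernel A P Q f X"
    using A f unfolding stable_dg_def by blast
  then have "h_short_exact A X"
    using A by (auto simp: h_cokernel_def h_short_exact_def stable_dg_def h_right_exact_def)
  then show ?thesis
    using X by (auto simp: inflation_def h_cokernel_def)
qed

theorem proposition6p4:
  fixes A :: "('o, 'm::ab_group_add, 'k::comm_ring_1) dg_cat"
  assumes "stable_dg A"
  shows "exact_dg_category A {X. h_short_exact A X}"
proof -
  let ?S = "{X. h_short_exact A X}"
  have add: "additive_dg A" using assms by (simp add: stable_dg_def)
  then interpret dg_category A by (simp add: additive_dg_def)
  have defl: "P \<in> Obj A \<and> Q \<in> Obj A \<and> f \<in> Z0 A P Q" if "deflation ?S P Q f" for P Q f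
    using that by (auto simp: deflation_def h_short_exact_def h_left_exact_def h_complex_def)
  have infl: "P \<in> Obj A \<and> Q \<in> Obj A \<and> f \<in> Z0 A P Q" if "inflation ?S P Q f" for P Q f
    using that by (auto simp: inflation_def h_short_exact_def h_left_exact_def h_complex_def)
  have biproduct: "\<exists>D \<iota>\<^sub>1 \<iota>\<^sub>2 \<pi>\<^sub>1 \<pi>\<^sub>2. biproduct_H0 A X Y D \<iota>\<^sub>1 \<iota>\<^sub>2 \<pi>\<^sub>1 \<pi>\<^sub>2" if "X \<in> Obj A" "Y \<in> Obj A" for X Y
    using add that by (simp add: additive_dg_def)
  have Z0_cmp: "g \<cdot>\<^bsub>A\<^esub> f \<in> Z0 A X Z"
    if "X \<in> Obj A" "Y \<in> Obj A" "Z \<in> Obj A" "f \<in> Z0 A X Y" "g \<in> Z0 A Y Z" for X Y Z f g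
    using that arr_cmp[of Y Z 0 g X 0 f 0] dif_cmp_closed_right[of Y Z 0 g X 0 f] zero_cmp[of X Y 0 f Z]
    by (simp add: Z0_iff)
  have Z0_add: "f + g \<in> Z0 A X Y" "f - g \<in> Z0 A X Y"
    if "X \<in> Obj A" "Y \<in> Obj A" "f \<in> Z0 A X Y" "g \<in> Z0 A X Y" for X Y f g
    using that dif_add_arr[of X Y 0 f g] dif_diff[of X Y 0 f g] by (simp_all add: Z0_iff arr_add arr_diff)
  have "exact_structure A ?S"
  proof
    show "h_short_exact A X" if "X \<in> ?S" for X using that by simp
    \<comment> \<open>Left exactness passes along the isomorphism; right exactness of
      \<open>X'\<close> then comes from stability, since \<open>X'\<close> is an h-complex by the
      definition of isomorphism.\<close>
    show "X' \<in> ?S" if "X \<in> ?S" "h_isomorphic A X X'" for X X'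
      using that h_left_exact_isomorphic assms by (auto simp: h_short_exact_def stable_dg_def h_isomorphic_def)
    show "deflation ?S N N (idn A N)" if "zero_object_H0 A N" for N
      using that by (intro stable_dg_deflation[OF assms]) (simp_all add: zero_object_H0_def Z0_def idn_closed dif_idn)
    show "deflation ?S B D (q \<cdot>\<^bsub>A\<^esub> p)" if "deflation ?S B C p" "deflation ?S C D q" for B C D p q
      using defl[OF that(1)] defl[OF that(2)] by (intro stable_dg_deflation[OF assms]) (auto intro: Z0_cmp)
    \<comment> \<open>For an arbitrary homotopy pullback, \<open>sq_p' Q\<close> is closed of degree
      \<open>0\<close> because \<open>Q\<close> is a homotopy square, and that already makes it a
      deflation.\<close>
    show "deflation ?S (sq_B' Q) C' (sq_p' Q)"
      if "deflation ?S B C p" "C' \<in> Obj A" "c \<in> Z0 A C' C" "h_pullback A B C C' p c Q" for B C C' p c Q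
      using that by (intro stable_dg_deflation[OF assms]) (auto simp: h_pullback_def h_cartesian_def h_square_def)
    show "inflation ?S P' (sq_C Q) (sq_p Q)"
      if "inflation ?S P B i" "P' \<in> Obj A" "a \<in> Z0 A P P'" "h_pushout A P' P B a i Q" for P B i P' a Q
      using that by (intro stable_dg_inflation[OF assms]) (auto simp: h_pushout_def h_cocartesian_def h_square_def)
    show "\<exists>Q. h_pullback A B C C' p c Q"
      if H: "deflation ?S B C p" "C' \<in> Obj A" "c \<in> Z0 A C' C" for B C C' p c
    proof -
      note p = defl[OF H(1)]
      obtain D \<iota>\<^sub>1 \<iota>\<^sub>2 \<pi>\<^sub>1 \<pi>\<^sub>2 where D: "biproduct_H0 A B C' D \<iota>\<^sub>1 \<iota>\<^sub>2 \<pi>\<^sub>1 \<pi>\<^sub>2"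
        using biproduct p H(2) by blast
      then have "D \<in> Obj A" "p \<cdot>\<^bsub>A\<^esub> \<pi>\<^sub>1 - c \<cdot>\<^bsub>A\<^esub> \<pi>\<^sub>2 \<in> Z0 A D C"
        using p H by (auto simp: biproduct_H0_def intro!: Z0_add(2) intro: Z0_cmp)
      then obtain X where "h_kernel A D C (p \<cdot>\<^bsub>A\<^esub> \<pi>\<^sub>1 - c \<cdot>\<^bsub>A\<^esub> \<pi>\<^sub>2) X"
        using assms p unfolding stable_dg_def by blast
      with D show ?thesis
        using h_cartesian_of_kernel p H unfolding h_pullback_def by fastforce
    qed
    \<comment> \<open>In the square, \<open>P'\<close> stands at the corner \<open>sq_B\<close> and
      \<open>B\<close> at \<open>sq_C'\<close>. Hence the biproduct is taken in the order
      \<open>P'\<close>, \<open>B\<close>, and the map parallel to \<open>i\<close> is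
      \<open>sq_p\<close>.\<close>
    show "\<exists>Q. h_pushout A P' P B a i Q"
      if H: "inflation ?S P B i" "P' \<in> Obj A" "a \<in> Z0 A P P'" for P B i P' a
    proof -
      note i = infl[OF H(1)]
      obtain D \<iota>\<^sub>1 \<iota>\<^sub>2 \<pi>\<^sub>1 \<pi>\<^sub>2 where D: "biproduct_H0 A P' B D \<iota>\<^sub>1 \<iota>\<^sub>2 \<pi>\<^sub>1 \<pi>\<^sub>2"
        using biproduct i H(2) by blast
      then have "D \<in> Obj A" "\<iota>\<^sub>1 \<cdot>\<^bsub>A\<^esub> a + \<iota>\<^sub>2 \<cdot>\<^bsub>A\<^esub> i \<in> Z0 A P D"
        using i H by (auto simp: biproduct_H0_def intro!: Z0_add(1) intro: Z0_cmp)
      then obtain X where "h_cokernel A P D (\<iota>\<^sub>1 \<cdot>\<^bsub>A\<^esub> a + \<iota>\<^sub>2 \<cdot>\<^bsub>A\<^esub> i) X"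
        using assms i unfolding stable_dg_def by blast
      with D show ?thesis
        using h_cocartesian_of_cokernel i H unfolding h_pushout_def by fastforce
    qed
  qed
  then show ?thesis
    using add by (simp add: exact_dg_category_def)
qed

end
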